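(* Each monotone graph limit has a representation as $\Gamma_W$ for some monotone kernel $W\in\mathcal W_\uparrow([0,1])$, with $W$ unique up to equality a.e. Furthermore, there is a homeomorphism between the set $\mathcal U_\uparrow$ of monotone graph limits and $\mathcal W_\uparrow([0,1])$, the latter regarded as a subset of $L^1([0,1]^2)$.
   Context: A kernel on a probability space $(S,\mu)$ is a symmetric measurable function $W:S^2\to[0,1]$; kernels equal a.e. are identified. For $W\in L^1(S^2)$ the cut norm is $\|W\|_{\square}=\sup\bigl|\int_{S^2}W(x,y)f(x)g(y)\,d\mu(x)\,d\mu(y)\bigr|$, the supremum being over measurable $f,g:S\to[-1,1]$. For kernels $W_1$ on $S_1$ and $W_2$ on $S_2$, $\delta_\square(W_1,W_2)=\inf\|W_1^{\varphi_1}-W_2^{\varphi_2}\|_\square$, the infimum being over all pairs of measure-preserving maps $\varphi_1:S_3\to S_1$, $\varphi_2:S_3\to S_2$ from a common probability space $S_3$, where $W^\varphi(x,y)=W(\varphi(x),\varphi(y))$. Kernels with $\delta_\square(W_1,W_2)=0$ are called equivalent. Graph limits are identified with equivalence classes of kernels, $\Gamma_W$ denoting the class of $W$ (every class contains a kernel on $[0,1]$ with Lebesgue measure); the set of graph limits carries the topology of the metric induced by $\delta_\square$. $\mathcal W_\uparrow([0,1])$ is the set of monotone kernels on $[0,1]$ (with Lebesgue measure), i.e., kernels $W$ with $W(x_1,y_1)\le W(x_2,y_2)$ whenever $0\le x_1\le x_2\le1$ and $0\le y_1\le y_2\le 1$. The set $\mathcal U_\uparrow$ of monotone graph limits is the set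 of graph limits of the form $\Gamma_W$ with $W\in\mathcal W_\uparrow([0,1])$, with the subspace topology. *)

theory Defs
  imports "HOL-Probability.Probability"
begin

definition kernels :: "'a measure \<Rightarrow> ('a \<times> 'a \<Rightarrow> real) set" where
  "kernels M = {W. W \<in> borel_measurable (M \<Otimes>\<^sub>M M)
     \<and> (\<forall>x\<in>space M. \<forall>y\<in>space M. W (x, y) = W (y, x))
     \<and> (\<forall>x\<in>space M. \<forall>y\<in>space M. 0 \<le> W (x, y) \<and> W (x, y) \<le> 1)}"

definition cut_norm :: "'a measure \<Rightarrow> ('a \<times> 'a \<Rightarrow> real) \<Rightarrow> real" where
  "cut_norm M W = Sup {\<bar>\<integral>(x, y). W (x, y) * f x * g y \<partial>(M \<Otimes>\<^sub>M M)\<bar> | f g.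
     f \<in> borel_measurable M \<and> (\<forall>x\<in>space M. -1 \<le> f x \<and> f x \<le> 1) \<and>
     g \<in> borel_measurable M \<and> (\<forall>x\<in>space M. -1 \<le> g x \<and> g x \<le> 1)}"

definition measure_preserving :: "'a measure \<Rightarrow> 'b measure \<Rightarrow> ('a \<Rightarrow> 'b) set" where
  "measure_preserving N M = {\<phi> \<in> N \<rightarrow>\<^sub>M M. distr N M \<phi> = M}"

definition pullback :: "('a \<times> 'a \<Rightarrow> real) \<Rightarrow> ('b \<Rightarrow> 'a) \<Rightarrow> 'b \<times> 'b \<Rightarrow> real" where
  "pullback W \<phi> = (\<lambda>(x, y). W (\<phi> x, \<phi> y))"

text \<open>
  HOL cannot quantify over the type of the common probability space \<open>N\<close>, so \<open>N\<close> ranges over all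
  probability spaces on the type \<open>'a \<times> 'b\<close>. This loses nothing: by \<open>cut_distance_le\<close> below, a pair
  of measure-preserving maps from a probability space on any other type never gives a smaller value,
  so this is the infimum over all probability spaces.
\<close>

definition cut_distance ::
    "'a measure \<Rightarrow> ('a \<times> 'a \<Rightarrow> real) \<Rightarrow> 'b measure \<Rightarrow> ('b \<times> 'b \<Rightarrow> real) \<Rightarrow> real" where
  "cut_distance M1 W1 M2 W2 =
     Inf {cut_norm N (\<lambda>z. pullback W1 \<phi>1 z - pullback W2 \<phi>2 z) | (N :: ('a \<times> 'b) measure) \<phi>1 \<phi>2.
       prob_space N \<and> \<phi>1 \<in> measure_preserving N M1 \<and> \<phi>2 \<in> measure_preserving N M2}"

lemma cut_norm_upper:
  assumes N: "prob_space N"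
    and V: "V \<in> borel_measurable (N \<Otimes>\<^sub>M N)"
    and bd: "\<And>x y. x \<in> space N \<Longrightarrow> y \<in> space N \<Longrightarrow> \<bar>V (x, y)\<bar> \<le> 1"
    and f: "f \<in> borel_measurable N" "\<forall>x\<in>space N. -1 \<le> f x \<and> f x \<le> 1"
    and g: "g \<in> borel_measurable N" "\<forall>x\<in>space N. -1 \<le> g x \<and> g x \<le> 1"
  shows "\<bar>\<integral>(x, y). V (x, y) * f x * g y \<partial>(N \<Otimes>\<^sub>M N)\<bar> \<le> cut_norm N V"
proof -
  interpret N: prob_space N by fact
  interpret NN: pair_prob_space N N ..
  have "\<bar>\<integral>(x, y). V (x, y) * f x * g y \<partial>(N \<Otimes>\<^sub>M N)\<bar> \<le> 1"
    if f: "f \<in> borel_measurable N" "\<forall>x\<in>space N. -1 \<le> f x \<and> f x \<le> 1"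
      and g: "g \<in> borel_measurable N" "\<forall>x\<in>space N. -1 \<le> g x \<and> g x \<le> 1" for f g
  proof -
    note [measurable] = V f(1) g(1)
    have le: "\<bar>V (x, y) * f x * g y\<bar> \<le> 1" if "x \<in> space N" "y \<in> space N" for x y
    proof -
      have "\<bar>f x\<bar> \<le> 1" "\<bar>g y\<bar> \<le> 1" using f(2) g(2) that by (auto simp: abs_le_iff)
      then show ?thesis
        using bd[OF that] by (simp add: abs_mult mult_le_one)
    qed
    have "\<bar>\<integral>(x, y). V (x, y) * f x * g y \<partial>(N \<Otimes>\<^sub>M N)\<bar>
        \<le> (\<integral>(x, y). \<bar>V (x, y) * f x * g y\<bar> \<partial>(N \<Otimes>\<^sub>M N))"
      using integral_abs_bound[of "N \<Otimes>\<^sub>M N" "\<lambda>(x, y). V (x, y) * f x * g y"]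
      by (simp only: split_beta')
    also have "\<dots> \<le> 1"
      by (rule NN.integral_le_const)
        (auto intro!: NN.integrable_const_bound[where B=1] AE_I2 simp: le space_pair_measure)
    finally show ?thesis .
  qed
  then have "bdd_above {\<bar>\<integral>(x, y). V (x, y) * f x * g y \<partial>(N \<Otimes>\<^sub>M N)\<bar> | f g.
     f \<in> borel_measurable N \<and> (\<forall>x\<in>space N. -1 \<le> f x \<and> f x \<le> 1) \<and>
     g \<in> borel_measurable N \<and> (\<forall>x\<in>space N. -1 \<le> g x \<and> g x \<le> 1)}"
    by (intro bdd_aboveI[of _ 1]) blast
  then show ?thesis
    unfolding cut_norm_def using f g by (intro cSup_upper) blast+
qed

lemma pullback_measurable:
  assumes "W \<in> borel_measurable (M \<Otimes>\<^sub>M M)" and \<phi>: "\<phi> \<in> N \<rightarrow>\<^sub>M M"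
  shows "pullback W \<phi> \<in> borel_measurable (N \<Otimes>\<^sub>M N)"
proof -
  note [measurable] = assms
  show ?thesis unfolding pullback_def by measurable
qed

lemma pullback_diff:
  assumes "prob_space N" "W1 \<in> kernels M1" "W2 \<in> kernels M2"
    and "\<phi>1 \<in> measure_preserving N M1" "\<phi>2 \<in> measure_preserving N M2"
  shows "(\<lambda>z. pullback W1 \<phi>1 z - pullback W2 \<phi>2 z) \<in> borel_measurable (N \<Otimes>\<^sub>M N)"
    and "x \<in> space N \<Longrightarrow> y \<in> space N \<Longrightarrow>
      \<bar>pullback W1 \<phi>1 (x, y) - pullback W2 \<phi>2 (x, y)\<bar> \<le> 1"
proof -
  have m: "\<phi>1 \<in> N \<rightarrow>\<^sub>M M1" "\<phi>2 \<in> N \<rightarrow>\<^sub>M M2"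
    using assms by (auto simp: measure_preserving_def)
  show "(\<lambda>z. pullback W1 \<phi>1 z - pullback W2 \<phi>2 z) \<in> borel_measurable (N \<Otimes>\<^sub>M N)"
    using assms m by (intro borel_measurable_diff pullback_measurable) (auto simp: kernels_def)
  assume "x \<in> space N" "y \<in> space N"
  then have "\<phi>1 x \<in> space M1" "\<phi>1 y \<in> space M1" "\<phi>2 x \<in> space M2" "\<phi>2 y \<in> space M2"
    using m by (auto dest: measurable_space)
  then have "0 \<le> W1 (\<phi>1 x, \<phi>1 y)" "W1 (\<phi>1 x, \<phi>1 y) \<le> 1"
      "0 \<le> W2 (\<phi>2 x, \<phi>2 y)" "W2 (\<phi>2 x, \<phi>2 y) \<le> 1"
    using assms by (auto simp: kernels_def)
  then show "\<bar>pullback W1 \<phi>1 (x, y) - pullback W2 \<phi>2 (x, y)\<bar> \<le> 1"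
    by (simp add: pullback_def)
qed

lemma cut_norm_nonneg:
  assumes "prob_space N" "V \<in> borel_measurable (N \<Otimes>\<^sub>M N)"
    and "\<And>x y. x \<in> space N \<Longrightarrow> y \<in> space N \<Longrightarrow> \<bar>V (x, y)\<bar> \<le> 1"
  shows "0 \<le> cut_norm N V"
  using cut_norm_upper[OF assms, of "\<lambda>_. 0" "\<lambda>_. 0"] by (simp add: split_beta')

lemma cut_distance_le:
  fixes N :: "'c measure" and M1 :: "'a measure" and M2 :: "'b measure"
  assumes N: "prob_space N" and W: "W1 \<in> kernels M1" "W2 \<in> kernels M2"
    and \<phi>: "\<phi>1 \<in> measure_preserving N M1" "\<phi>2 \<in> measure_preserving N M2"
  shows "cut_distance M1 W1 M2 W2 \<le> cut_norm N (\<lambda>z. pullback W1 \<phi>1 z - pullback W2 \<phi>2 z)"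
proof -
  interpret N: prob_space N by fact
  have [measurable]: "\<phi>1 \<in> N \<rightarrow>\<^sub>M M1" "\<phi>2 \<in> N \<rightarrow>\<^sub>M M2"
    and d: "distr N M1 \<phi>1 = M1" "distr N M2 \<phi>2 = M2"
    using \<phi> by (auto simp: measure_preserving_def)
  define \<psi> where "\<psi> = (\<lambda>x. (\<phi>1 x, \<phi>2 x))"
  have \<psi>[measurable]: "\<psi> \<in> N \<rightarrow>\<^sub>M M1 \<Otimes>\<^sub>M M2" unfolding \<psi>_def by measurable
  define P where "P = distr N (M1 \<Otimes>\<^sub>M M2) \<psi>"
  have P: "prob_space P" unfolding P_def by (rule N.prob_space_distr) measurable
  interpret P: prob_space P by fact
  have sP[measurable_cong]: "sets P = sets (M1 \<Otimes>\<^sub>M M2)" by (simp add: P_def)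
  have fs: "fst \<in> measure_preserving P M1" "snd \<in> measure_preserving P M2"
    using d by (auto simp: measure_preserving_def P_def distr_distr o_def \<psi>_def)
  let ?V = "\<lambda>z. pullback W1 fst z - pullback W2 snd z"
  let ?U = "\<lambda>z. pullback W1 \<phi>1 z - pullback W2 \<phi>2 z"
  have [measurable]: "?V \<in> borel_measurable (P \<Otimes>\<^sub>M P)"
    by (rule pullback_diff(1)[OF P W fs])
  have PP: "P \<Otimes>\<^sub>M P = distr (N \<Otimes>\<^sub>M N) (P \<Otimes>\<^sub>M P) (\<lambda>(x, y). (\<psi> x, \<psi> y))"
  proof -
    have "distr N P \<psi> = P" unfolding P_def by (rule distr_cong) auto
    moreover have "distr N P \<psi> \<Otimes>\<^sub>M distr N P \<psi> = distr (N \<Otimes>\<^sub>M N) (P \<Otimes>\<^sub>M P) (\<lambda>(x, y). (\<psi> x, \<psi> y))"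
      using calculation P.sigma_finite_measure_axioms by (intro pair_measure_distr) auto
    ultimately show ?thesis by simp
  qed
  have "cut_norm P ?V \<le> cut_norm N ?U"
    unfolding cut_norm_def[of P]
  proof (rule cSup_least)
    show "{\<bar>\<integral>(x, y). ?V (x, y) * f x * g y \<partial>(P \<Otimes>\<^sub>M P)\<bar> | f g.
     f \<in> borel_measurable P \<and> (\<forall>x\<in>space P. -1 \<le> f x \<and> f x \<le> 1) \<and>
     g \<in> borel_measurable P \<and> (\<forall>x\<in>space P. -1 \<le> g x \<and> g x \<le> 1)} \<noteq> {}"
      by (auto intro!: exI[of _ "\<lambda>_. 0"])
  next
    fix r assume "r \<in> {\<bar>\<integral>(x, y). ?V (x, y) * f x * g y \<partial>(P \<Otimes>\<^sub>M P)\<bar> | f g.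
     f \<in> borel_measurable P \<and> (\<forall>x\<in>space P. -1 \<le> f x \<and> f x \<le> 1) \<and>
     g \<in> borel_measurable P \<and> (\<forall>x\<in>space P. -1 \<le> g x \<and> g x \<le> 1)}"
    then obtain f g where r: "r = \<bar>\<integral>(x, y). ?V (x, y) * f x * g y \<partial>(P \<Otimes>\<^sub>M P)\<bar>"
      and fm[measurable]: "f \<in> borel_measurable P" and f: "\<forall>x\<in>space P. -1 \<le> f x \<and> f x \<le> 1"
      and gm[measurable]: "g \<in> borel_measurable P" and g: "\<forall>x\<in>space P. -1 \<le> g x \<and> g x \<le> 1"
      by blast
    have \<psi>P[measurable]: "\<psi> \<in> N \<rightarrow>\<^sub>M P" by measurable
    have "(\<integral>(x, y). ?V (x, y) * f x * g y \<partial>(P \<Otimes>\<^sub>M P))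
        = (\<integral>(x, y). ?U (x, y) * f (\<psi> x) * g (\<psi> y) \<partial>(N \<Otimes>\<^sub>M N))"
    proof -
      have F: "(\<lambda>z. ?V z * f (fst z) * g (snd z)) \<in> borel_measurable (P \<Otimes>\<^sub>M P)"
        by (intro borel_measurable_times measurable_compose[OF measurable_fst fm]
            measurable_compose[OF measurable_snd gm]) fact
      have T: "(\<lambda>(x, y). (\<psi> x, \<psi> y)) \<in> N \<Otimes>\<^sub>M N \<rightarrow>\<^sub>M P \<Otimes>\<^sub>M P" by measurable
      show ?thesis
        using integral_distr[OF T F, folded PP]
        by (simp add: split_beta' pullback_def \<psi>_def)
    qed
    also have "\<bar>\<dots>\<bar> \<le> cut_norm N ?U"
      using measurable_space[OF \<psi>P] f g
      by (intro cut_norm_upper[OF N pullback_diff[OF N W \<phi>]]) auto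
    finally show "r \<le> cut_norm N ?U" using r by simp
  qed
  moreover have "cut_distance M1 W1 M2 W2 \<le> cut_norm P ?V"
    unfolding cut_distance_def
  proof (rule cInf_lower)
    show "cut_norm P ?V \<in> {cut_norm N (\<lambda>z. pullback W1 \<phi>1 z - pullback W2 \<phi>2 z)
       | (N :: ('a \<times> 'b) measure) \<phi>1 \<phi>2.
       prob_space N \<and> \<phi>1 \<in> measure_preserving N M1 \<and> \<phi>2 \<in> measure_preserving N M2}"
      using P fs by blast
    show "bdd_below {cut_norm N (\<lambda>z. pullback W1 \<phi>1 z - pullback W2 \<phi>2 z)
       | (N :: ('a \<times> 'b) measure) \<phi>1 \<phi>2.
       prob_space N \<and> \<phi>1 \<in> measure_preserving N M1 \<and> \<phi>2 \<in> measure_preserving N M2}"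
      using W by (intro bdd_belowI[of _ 0]) (auto intro!: cut_norm_nonneg pullback_diff)
  qed
  ultimately show ?thesis by linarith
qed

abbreviation unit_leb :: "real measure" where
  "unit_leb \<equiv> lebesgue_on {0..1}"

text \<open>
  Every equivalence class of kernels contains a kernel on \<open>[0,1]\<close>, so a graph limit is represented by
  the set of the kernels on \<open>[0,1]\<close> that belong to it.
\<close>

definition kernel_equiv :: "((real \<times> real \<Rightarrow> real) \<times> (real \<times> real \<Rightarrow> real)) set" where
  "kernel_equiv = {(W, W'). W \<in> kernels unit_leb \<and> W' \<in> kernels unit_leb \<and>
     cut_distance unit_leb W unit_leb W' = 0}"

definition graph_limits :: "(real \<times> real \<Rightarrow> real) set set" where
  "graph_limits = kernels unit_leb // kernel_equiv"

definition graph_limit_of :: "(real \<times> real \<Rightarrow> real) \<Rightarrow> (real \<times> real \<Rightarrow> real) set" where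
  "graph_limit_of W = kernel_equiv `` {W}"

text \<open>
  The value 0 off the carrier is there because \<^locale>\<open>Metric_space\<close> asks for nonnegativity on the
  whole type.
\<close>

definition graph_limit_dist ::
    "(real \<times> real \<Rightarrow> real) set \<Rightarrow> (real \<times> real \<Rightarrow> real) set \<Rightarrow> real" where
  "graph_limit_dist A B = (if A \<in> graph_limits \<and> B \<in> graph_limits
     then cut_distance unit_leb (SOME W. W \<in> A) unit_leb (SOME W. W \<in> B) else 0)"

definition graph_limit_topology :: "(real \<times> real \<Rightarrow> real) set topology" where
  "graph_limit_topology = Metric_space.mtopology graph_limits graph_limit_dist"

definition monotone_kernels :: "(real \<times> real \<Rightarrow> real) set" where
  "monotone_kernels = {W \<in> kernels unit_leb. \<forall>x1 x2 y1 y2.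
     0 \<le> x1 \<and> x1 \<le> x2 \<and> x2 \<le> 1 \<and> 0 \<le> y1 \<and> y1 \<le> y2 \<and> y2 \<le> 1 \<longrightarrow> W (x1, y1) \<le> W (x2, y2)}"

definition monotone_graph_limits :: "(real \<times> real \<Rightarrow> real) set set" where
  "monotone_graph_limits = graph_limit_of ` monotone_kernels"

definition L1_equiv :: "'a measure \<Rightarrow> (('a \<Rightarrow> real) \<times> ('a \<Rightarrow> real)) set" where
  "L1_equiv M = {(f, g). integrable M f \<and> integrable M g \<and> (AE x in M. f x = g x)}"

definition L1_space :: "'a measure \<Rightarrow> ('a \<Rightarrow> real) set set" where
  "L1_space M = {f. integrable M f} // L1_equiv M"

definition L1_class :: "'a measure \<Rightarrow> ('a \<Rightarrow> real) \<Rightarrow> ('a \<Rightarrow> real) set" where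
  "L1_class M f = L1_equiv M `` {f}"

definition L1_dist :: "'a measure \<Rightarrow> ('a \<Rightarrow> real) set \<Rightarrow> ('a \<Rightarrow> real) set \<Rightarrow> real" where
  "L1_dist M A B = (\<integral>x. \<bar>(SOME f. f \<in> A) x - (SOME g. g \<in> B) x\<bar> \<partial>M)"

definition L1_topology :: "'a measure \<Rightarrow> ('a \<Rightarrow> real) set topology" where
  "L1_topology M = Metric_space.mtopology (L1_space M) (L1_dist M)"

end

theory Submission
  imports Defs
begin

text \<open>
  The key estimate compares the masses of upper quadrants. In any coupling \<open>(\<phi>1, \<phi>2)\<close> of \<open>[0,1]\<close> with
  itself, an increasing function of \<open>\<phi>2\<close> has a larger integral against \<open>1{\<phi>2 \<ge> a}\<close> than against any
  other \<open>[0,1]\<close>-valued function of the same mean, in particular \<open>1{\<phi>1 \<ge> a}\<close>. Hence the integrals of two monotone kernels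
  over \<open>[a,1] \<times> [b,1]\<close> differ by at most their cut distance \<open>\<delta>\<close>, and by inclusion-exclusion their
  integrals over a square of side \<open>h\<close> differ by at most \<open>4\<delta>\<close>. Monotonicity gives
  \<open>W1(x, y) \<le> W2(x + h, y + h) + 4\<delta>/h\<^sup>2\<close>, and integrating yields
  \<open>\<parallel>W1 - W2\<parallel>\<^sub>1 \<le> 4\<delta>/h\<^sup>2 + 6h\<close> for every \<open>0 < h < 1\<close>, whereas \<open>\<delta> \<le> \<parallel>W1 - W2\<parallel>\<^sub>1\<close> is trivial. So on monotone kernels
  the cut distance and the \<open>L\<^sup>1\<close> distance are uniformly equivalent.

  That the cut distance satisfies the triangle inequality is shown by approximating the middle kernel
  in \<open>L\<^sup>1\<close> by a step kernel and gluing the two couplings along the cells of its partition.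
\<close>

subsection \<open>The cut norm under measure-preserving maps\<close>

lemma kernelsD:
  assumes "W \<in> kernels M"
  shows "W \<in> borel_measurable (M \<Otimes>\<^sub>M M)"
    and "x \<in> space M \<Longrightarrow> y \<in> space M \<Longrightarrow> W (x, y) = W (y, x)"
    and "x \<in> space M \<Longrightarrow> y \<in> space M \<Longrightarrow> 0 \<le> W (x, y)"
    and "x \<in> space M \<Longrightarrow> y \<in> space M \<Longrightarrow> W (x, y) \<le> 1"
  using assms by (auto simp: kernels_def)

lemma cut_norm_least:
  assumes "\<And>f g. f \<in> borel_measurable N \<Longrightarrow> (\<And>x. x \<in> space N \<Longrightarrow> \<bar>f x\<bar> \<le> 1) \<Longrightarrow>
      g \<in> borel_measurable N \<Longrightarrow> (\<And>x. x \<in> space N \<Longrightarrow> \<bar>g x\<bar> \<le> 1) \<Longrightarrow>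
      \<bar>\<integral>(x, y). V (x, y) * f x * g y \<partial>(N \<Otimes>\<^sub>M N)\<bar> \<le> c"
  shows "cut_norm N V \<le> c"
  unfolding cut_norm_def
proof (rule cSup_least)
  show "{\<bar>\<integral>(x, y). V (x, y) * f x * g y \<partial>(N \<Otimes>\<^sub>M N)\<bar> | f g.
     f \<in> borel_measurable N \<and> (\<forall>x\<in>space N. -1 \<le> f x \<and> f x \<le> 1) \<and>
     g \<in> borel_measurable N \<and> (\<forall>x\<in>space N. -1 \<le> g x \<and> g x \<le> 1)} \<noteq> {}"
    by (auto intro!: exI[of _ "\<lambda>_. 0"])
qed (use assms in \<open>force simp: abs_le_iff\<close>)

lemma cut_norm_minus: "cut_norm N (\<lambda>z. - V z) = cut_norm N V"
proof -
  have *: "(\<integral>(x, y). - V (x, y) * f x * g y \<partial>(N \<Otimes>\<^sub>M N)) =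
      - (\<integral>(x, y). V (x, y) * f x * g y \<partial>(N \<Otimes>\<^sub>M N))" for f g :: "'a \<Rightarrow> real"
    by (subst integral_minus[symmetric]) (simp add: split_beta')
  show ?thesis
    unfolding cut_norm_def * abs_minus_cancel ..
qed

context prob_space
begin

lemma integrable_cut_test:
  fixes V :: "'a \<times> 'a \<Rightarrow> real"
  assumes [measurable]: "V \<in> borel_measurable (M \<Otimes>\<^sub>M M)" "f \<in> borel_measurable M" "g \<in> borel_measurable M"
    and "\<And>x y. x \<in> space M \<Longrightarrow> y \<in> space M \<Longrightarrow> \<bar>V (x, y)\<bar> \<le> 1"
    and "\<And>x. x \<in> space M \<Longrightarrow> \<bar>f x\<bar> \<le> 1" "\<And>x. x \<in> space M \<Longrightarrow> \<bar>g x\<bar> \<le> 1"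
  shows "integrable (M \<Otimes>\<^sub>M M) (\<lambda>(x, y). V (x, y) * f x * g y)"
proof -
  interpret MM: pair_prob_space M M ..
  show ?thesis
    by (rule MM.integrable_const_bound[where B=1])
      (auto intro!: AE_I2 mult_le_one simp: space_pair_measure abs_mult assms(4-))
qed

lemma cut_norm_le_L1:
  assumes [measurable]: "V \<in> borel_measurable (M \<Otimes>\<^sub>M M)"
    and bd: "\<And>x y. x \<in> space M \<Longrightarrow> y \<in> space M \<Longrightarrow> \<bar>V (x, y)\<bar> \<le> 1"
  shows "cut_norm M V \<le> (\<integral>z. \<bar>V z\<bar> \<partial>(M \<Otimes>\<^sub>M M))"
proof (rule cut_norm_least)
  interpret MM: pair_prob_space M M ..
  fix f g :: "'a \<Rightarrow> real"
  assume [measurable]: "f \<in> borel_measurable M" "g \<in> borel_measurable M"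
    and fg: "\<And>x. x \<in> space M \<Longrightarrow> \<bar>f x\<bar> \<le> 1" "\<And>x. x \<in> space M \<Longrightarrow> \<bar>g x\<bar> \<le> 1"
  have int: "integrable (M \<Otimes>\<^sub>M M) (\<lambda>(x, y). V (x, y) * f x * g y)"
    using bd fg by (intro integrable_cut_test) auto
  have intV: "integrable (M \<Otimes>\<^sub>M M) V"
    using bd by (intro MM.integrable_const_bound[where B=1] AE_I2) (auto simp: space_pair_measure)
  have "\<bar>\<integral>(x, y). V (x, y) * f x * g y \<partial>(M \<Otimes>\<^sub>M M)\<bar>
      \<le> (\<integral>z. \<bar>(\<lambda>(x, y). V (x, y) * f x * g y) z\<bar> \<partial>(M \<Otimes>\<^sub>M M))"
    by (rule integral_abs_bound)
  also have "\<dots> \<le> (\<integral>z. \<bar>V z\<bar> \<partial>(M \<Otimes>\<^sub>M M))"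
  proof (intro integral_mono integrable_abs int intV)
    fix z assume "z \<in> space (M \<Otimes>\<^sub>M M)"
    then have "\<bar>f (fst z)\<bar> * \<bar>g (snd z)\<bar> \<le> 1"
      by (intro mult_le_one fg) (auto simp: space_pair_measure)
    then show "\<bar>(\<lambda>(x, y). V (x, y) * f x * g y) z\<bar> \<le> \<bar>V z\<bar>"
      by (auto simp: split_beta' abs_mult mult.assoc intro!: mult_left_le)
  qed
  finally show "\<bar>\<integral>(x, y). V (x, y) * f x * g y \<partial>(M \<Otimes>\<^sub>M M)\<bar> \<le> (\<integral>z. \<bar>V z\<bar> \<partial>(M \<Otimes>\<^sub>M M))" .
qed

text \<open>The bound 1 is placed on the summands, where \<open>cut_norm_upper\<close> is applied;
  the sum is estimated only through its test integrals, so its values may reach 2.\<close>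

lemma cut_norm_add_le:
  assumes UV: "U \<in> borel_measurable (M \<Otimes>\<^sub>M M)" "V \<in> borel_measurable (M \<Otimes>\<^sub>M M)"
    and bd: "\<And>x y. x \<in> space M \<Longrightarrow> y \<in> space M \<Longrightarrow> \<bar>U (x, y)\<bar> \<le> 1"
      "\<And>x y. x \<in> space M \<Longrightarrow> y \<in> space M \<Longrightarrow> \<bar>V (x, y)\<bar> \<le> 1"
  shows "cut_norm M (\<lambda>z. U z + V z) \<le> cut_norm M U + cut_norm M V"
proof (rule cut_norm_least)
  fix f g :: "'a \<Rightarrow> real"
  assume fg[measurable]: "f \<in> borel_measurable M" "g \<in> borel_measurable M"
    and fg1: "\<And>x. x \<in> space M \<Longrightarrow> \<bar>f x\<bar> \<le> 1" "\<And>x. x \<in> space M \<Longrightarrow> \<bar>g x\<bar> \<le> 1"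
  have fg2: "\<forall>x\<in>space M. -1 \<le> f x \<and> f x \<le> 1" "\<forall>x\<in>space M. -1 \<le> g x \<and> g x \<le> 1"
    using fg1 by (force simp: abs_le_iff)+
  have "(\<integral>(x, y). (U (x, y) + V (x, y)) * f x * g y \<partial>(M \<Otimes>\<^sub>M M)) =
      (\<integral>z. (\<lambda>(x, y). U (x, y) * f x * g y) z + (\<lambda>(x, y). V (x, y) * f x * g y) z \<partial>(M \<Otimes>\<^sub>M M))"
    by (rule Bochner_Integration.integral_cong) (auto simp: algebra_simps)
  also have "\<dots> = (\<integral>(x, y). U (x, y) * f x * g y \<partial>(M \<Otimes>\<^sub>M M)) +
      (\<integral>(x, y). V (x, y) * f x * g y \<partial>(M \<Otimes>\<^sub>M M))"
    by (intro Bochner_Integration.integral_add integrable_cut_test UV fg bd fg1)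
  also have "\<bar>\<dots>\<bar> \<le> cut_norm M U + cut_norm M V"
    by (rule order_trans[OF abs_triangle_ineq])
      (intro add_mono cut_norm_upper[OF prob_space_axioms] UV fg bd fg2)
  finally show "\<bar>\<integral>(x, y). (U (x, y) + V (x, y)) * f x * g y \<partial>(M \<Otimes>\<^sub>M M)\<bar>
      \<le> cut_norm M U + cut_norm M V" .
qed

end

section \<open>Measure-preserving maps and change of variables\<close>

lemma measure_preservingD:
  assumes "\<phi> \<in> measure_preserving N M"
  shows "\<phi> \<in> N \<rightarrow>\<^sub>M M" "distr N M \<phi> = M"
  using assms by (auto simp: measure_preserving_def)

lemma measure_preserving_comp:
  assumes "\<phi> \<in> measure_preserving N M" "\<psi> \<in> measure_preserving P N"
  shows "(\<lambda>x. \<phi> (\<psi> x)) \<in> measure_preserving P M"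
proof -
  note [measurable] = assms[THEN measure_preservingD(1)]
  have "distr P M (\<lambda>x. \<phi> (\<psi> x)) = distr (distr P N \<psi>) M \<phi>"
    by (simp add: distr_distr o_def)
  then show ?thesis
    using assms by (simp add: measure_preserving_def measurable_compose[of \<psi> P N \<phi> M])
qed

lemma measure_preserving_prob_space:
  assumes "\<phi> \<in> measure_preserving N M" "prob_space N"
  shows "prob_space M"
  using prob_space.prob_space_distr[OF assms(2) measure_preservingD(1)[OF assms(1)]]
    measure_preservingD(2)[OF assms(1)] by simp

lemma integral_measure_preserving:
  fixes u :: "_ \<Rightarrow> real"
  assumes "\<phi> \<in> measure_preserving N M" "u \<in> borel_measurable M"
  shows "(\<integral>x. u (\<phi> x) \<partial>N) = (\<integral>x. u x \<partial>M)"
  using integral_distr[OF measure_preservingD(1)[OF assms(1)] assms(2)]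
  by (simp add: measure_preservingD(2)[OF assms(1)])

text \<open>For the change of variables in double integrals: it gives a kernel and its pullback the
  same integral.\<close>

lemma measure_preserving_pair:
  assumes "prob_space N" and \<phi>: "\<phi> \<in> measure_preserving N M"
  shows "(\<lambda>(x, y). (\<phi> x, \<phi> y)) \<in> measure_preserving (N \<Otimes>\<^sub>M N) (M \<Otimes>\<^sub>M M)"
proof -
  note [measurable] = measure_preservingD(1)[OF \<phi>]
  interpret M: prob_space M by (rule measure_preserving_prob_space[OF \<phi> assms(1)])
  have "distr N M \<phi> \<Otimes>\<^sub>M distr N M \<phi> = distr (N \<Otimes>\<^sub>M N) (M \<Otimes>\<^sub>M M) (\<lambda>(x, y). (\<phi> x, \<phi> y))"
    by (intro pair_measure_distr) (auto simp: measure_preservingD(2)[OF \<phi>] M.sigma_finite_measure_axioms)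
  then show ?thesis
    by (simp add: measure_preserving_def measure_preservingD(2)[OF \<phi>])
qed

text \<open>The function \<open>F\<close> is the conditional expectation of \<open>f\<close> given \<open>\<pi>\<close>, as a function on the target.\<close>

lemma conditional_expectation_factor:
  assumes P: "prob_space P" and \<pi>: "\<pi> \<in> measure_preserving P N"
    and f[measurable]: "f \<in> borel_measurable P" and f1: "\<And>x. x \<in> space P \<Longrightarrow> \<bar>f x\<bar> \<le> (1::real)"
  obtains F where "F \<in> borel_measurable N" "\<And>x. x \<in> space N \<Longrightarrow> \<bar>F x\<bar> \<le> (1::real)"
    "\<And>u. u \<in> borel_measurable N \<Longrightarrow> (\<And>x. x \<in> space N \<Longrightarrow> \<bar>u x\<bar> \<le> (1::real)) \<Longrightarrow>
      (\<integral>s. u (\<pi> s) * f s \<partial>P) = (\<integral>x. u x * F x \<partial>N)"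
proof -
  interpret P: prob_space P by fact
  interpret N: prob_space N by (rule measure_preserving_prob_space[OF \<pi> P])
  have [measurable]: "\<pi> \<in> P \<rightarrow>\<^sub>M N" and d: "distr P N \<pi> = N"
    using \<pi> by (auto simp: measure_preserving_def)
  \<comment> \<open>An affine change to values in \<open>[0,1]\<close> turns \<open>f\<close> into a
    density; it is undone at the end by \<open>2 * F' x - 1\<close>.\<close>
  define f' where "f' x = (f x + 1) / 2" for x
  have [measurable]: "f' \<in> borel_measurable P" unfolding f'_def by measurable
  have f': "0 \<le> f' x" "f' x \<le> 1" if "x \<in> space P" for x
    using f1[OF that] by (auto simp: f'_def)
  \<comment> \<open>The image under \<open>\<pi>\<close> of the measure with density
    \<open>f'\<close>. Since \<open>f' \<le> 1\<close>, it is dominated by \<open>N\<close>, and its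
    Radon-Nikodym derivative is the conditional expectation of \<open>f'\<close>.\<close>
  define \<nu> where "\<nu> = distr (density P f') N \<pi>"
  have \<nu>_le: "emeasure \<nu> A \<le> emeasure N A" if [measurable]: "A \<in> sets N" for A
  proof -
    have "emeasure \<nu> A = (\<integral>\<^sup>+x\<in>\<pi> -` A \<inter> space P. ennreal (f' x) \<partial>P)"
      by (simp add: \<nu>_def emeasure_distr emeasure_density)
    also have "\<dots> \<le> (\<integral>\<^sup>+x. indicator (\<pi> -` A \<inter> space P) x \<partial>P)"
      by (intro nn_integral_mono) (auto split: split_indicator simp: f')
    also have "\<dots> = emeasure N A"
      by (subst d[symmetric]) (simp add: emeasure_distr)
    finally show ?thesis .
  qed
  have "absolutely_continuous N \<nu>"
    unfolding absolutely_continuous_def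
  proof
    fix A assume "A \<in> null_sets N"
    then show "A \<in> null_sets \<nu>" using \<nu>_le[of A] by (auto simp: null_sets_def \<nu>_def)
  qed
  then obtain D where D[measurable]: "D \<in> borel_measurable N" and "density N D = \<nu>"
    using N.Radon_Nikodym[of \<nu>] by (auto simp: \<nu>_def)
  have D1: "AE x in N. D x \<le> 1"
  proof -
    \<comment> \<open>The excess of \<open>D\<close> over 1 integrates over \<open>A\<close> to the
      difference of \<open>\<nu>\<close> and \<open>N\<close> on \<open>A\<close>. That difference
      is 0 in truncated subtraction because \<open>\<nu>\<close> is dominated by \<open>N\<close>,
      so the excess vanishes a.e.\<close>
    define A where "A = {x \<in> space N. 1 < D x}"
    have [measurable]: "A \<in> sets N" unfolding A_def by measurable
    have "(\<integral>\<^sup>+x. D x * indicator A x - indicator A x \<partial>N) =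
        (\<integral>\<^sup>+x. D x * indicator A x \<partial>N) - (\<integral>\<^sup>+x. indicator A x \<partial>N)"
    proof (rule nn_integral_diff)
      show "AE x in N. indicator A x \<le> D x * indicator A x"
        by (auto split: split_indicator simp: A_def)
    qed (auto simp: N.emeasure_eq_measure)
    also have "(\<integral>\<^sup>+x. D x * indicator A x \<partial>N) = emeasure \<nu> A"
      by (simp add: \<open>density N D = \<nu>\<close>[symmetric] emeasure_density)
    also have "\<dots> - (\<integral>\<^sup>+x. indicator A x \<partial>N) = 0"
      using \<nu>_le[of A] by (simp add: diff_eq_0_iff_ennreal N.emeasure_eq_measure le_less_trans)
    finally have "AE x in N. D x * indicator A x - indicator A x = 0"
      by (simp add: nn_integral_0_iff_AE)
    with AE_space show ?thesis
    proof eventually_elim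
      case (elim x)
      then show ?case by (cases "1 < D x") (auto simp: A_def diff_eq_0_iff_ennreal not_less)
    qed
  qed
  \<comment> \<open>The cut-off at 1 changes \<open>D\<close> only on a null set and makes the
    bounds hold at every point, as a test function requires.\<close>
  define F' where "F' x = enn2real (min 1 (D x))" for x
  have [measurable]: "F' \<in> borel_measurable N" unfolding F'_def by measurable
  have F'01: "0 \<le> F' x" "F' x \<le> 1" for x
    by (auto simp: F'_def enn2real_leI)
  have "density N F' = \<nu>"
    unfolding \<open>density N D = \<nu>\<close>[symmetric]
    using D1 by (intro density_cong) (auto simp: F'_def min_def ennreal_enn2real_if top.extremum_unique)
  have key: "(\<integral>s. f' s * u (\<pi> s) \<partial>P) = (\<integral>x. F' x * u x \<partial>N)"
    if [measurable]: "u \<in> borel_measurable N" for u :: "_ \<Rightarrow> real"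
  proof -
    have "(\<integral>s. f' s * u (\<pi> s) \<partial>P) = (\<integral>s. u (\<pi> s) \<partial>(density P f'))"
      using f' by (subst integral_real_density) auto
    also have "\<dots> = (\<integral>x. u x \<partial>\<nu>)"
      unfolding \<nu>_def by (subst integral_distr) auto
    also have "\<dots> = (\<integral>x. F' x * u x \<partial>N)"
      unfolding \<open>density N F' = \<nu>\<close>[symmetric] using F'01 by (subst integral_real_density) auto
    finally show ?thesis .
  qed
  show ?thesis
  proof (rule that[of "\<lambda>x. 2 * F' x - 1"])
    show "\<bar>2 * F' x - 1\<bar> \<le> 1" for x using F'01[of x] by auto
    fix u :: "_ \<Rightarrow> real"
    assume u[measurable]: "u \<in> borel_measurable N" and u1: "\<And>x. x \<in> space N \<Longrightarrow> \<bar>u x\<bar> \<le> 1"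
    have u\<pi>: "\<bar>u (\<pi> s)\<bar> \<le> 1" if "s \<in> space P" for s
      using u1 measurable_space[OF \<open>\<pi> \<in> P \<rightarrow>\<^sub>M N\<close> that] by auto
    have i: "integrable P (\<lambda>s. f' s * u (\<pi> s))" "integrable P (\<lambda>s. u (\<pi> s))"
      using f' u\<pi> by (auto intro!: P.integrable_const_bound[where B=1] AE_I2 simp: abs_mult mult_le_one)
    have j: "integrable N (\<lambda>s. F' s * u s)" "integrable N u"
      using F'01 u1 by (auto intro!: N.integrable_const_bound[where B=1] AE_I2 simp: abs_mult mult_le_one)
    have "(\<integral>s. u (\<pi> s) * f s \<partial>P) = (\<integral>s. 2 * (f' s * u (\<pi> s)) - u (\<pi> s) \<partial>P)"
      by (intro Bochner_Integration.integral_cong) (auto simp: f'_def algebra_simps)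
    also have "\<dots> = 2 * (\<integral>s. f' s * u (\<pi> s) \<partial>P) - (\<integral>s. u (\<pi> s) \<partial>P)"
      using i by simp
    also have "\<dots> = 2 * (\<integral>x. F' x * u x \<partial>N) - (\<integral>x. u x \<partial>N)"
      by (simp add: key integral_measure_preserving[OF \<pi>])
    also have "\<dots> = (\<integral>x. 2 * (F' x * u x) - u x \<partial>N)"
      using j by simp
    also have "\<dots> = (\<integral>x. u x * (2 * F' x - 1) \<partial>N)"
      by (simp add: algebra_simps)
    finally show "(\<integral>s. u (\<pi> s) * f s \<partial>P) = (\<integral>x. u x * (2 * F' x - 1) \<partial>N)" .
  qed measurable
qed

text \<open>Test functions on \<open>P\<close> may vary within the fibres of \<open>\<pi>\<close>,
  but a kernel pulled back along \<open>\<pi>\<close> sees only their conditional expectations given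
  \<open>\<pi>\<close>, and these are test functions on \<open>N\<close>.\<close>

lemma cut_norm_pullback_le:
  assumes P: "prob_space P" and \<pi>: "\<pi> \<in> measure_preserving P N"
    and V[measurable]: "V \<in> borel_measurable (N \<Otimes>\<^sub>M N)"
    and V1: "\<And>x y. x \<in> space N \<Longrightarrow> y \<in> space N \<Longrightarrow> \<bar>V (x, y)\<bar> \<le> 1"
  shows "cut_norm P (pullback V \<pi>) \<le> cut_norm N V"
proof (rule cut_norm_least)
  interpret P: prob_space P by fact
  have N: "prob_space N" by (rule measure_preserving_prob_space[OF \<pi> P])
  then interpret N: prob_space N .
  interpret PP: pair_prob_space P P ..
  interpret NN: pair_prob_space N N ..
  note [measurable] = measure_preservingD(1)[OF \<pi>]
  note \<pi>_space = measurable_space[OF measure_preservingD(1)[OF \<pi>]]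
  fix f g :: "_ \<Rightarrow> real"
  assume f[measurable]: "f \<in> borel_measurable P" and f1: "\<And>x. x \<in> space P \<Longrightarrow> \<bar>f x\<bar> \<le> 1"
    and g[measurable]: "g \<in> borel_measurable P" and g1: "\<And>x. x \<in> space P \<Longrightarrow> \<bar>g x\<bar> \<le> 1"
  obtain F where F[measurable]: "F \<in> borel_measurable N" and F1: "\<And>x. x \<in> space N \<Longrightarrow> \<bar>F x\<bar> \<le> 1"
    and Fu: "\<And>u. u \<in> borel_measurable N \<Longrightarrow> (\<And>x. x \<in> space N \<Longrightarrow> \<bar>u x\<bar> \<le> 1) \<Longrightarrow>
      (\<integral>s. u (\<pi> s) * f s \<partial>P) = (\<integral>x. u x * F x \<partial>N)"
    using conditional_expectation_factor[OF P \<pi> f f1] by blast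
  obtain G where G[measurable]: "G \<in> borel_measurable N" and G1: "\<And>x. x \<in> space N \<Longrightarrow> \<bar>G x\<bar> \<le> 1"
    and Gu: "\<And>u. u \<in> borel_measurable N \<Longrightarrow> (\<And>x. x \<in> space N \<Longrightarrow> \<bar>u x\<bar> \<le> 1) \<Longrightarrow>
      (\<integral>s. u (\<pi> s) * g s \<partial>P) = (\<integral>x. u x * G x \<partial>N)"
    using conditional_expectation_factor[OF P \<pi> g g1] by blast
  \<comment> \<open>By Fubini the test functions are replaced one at a time: \<open>g\<close> by
    \<open>G\<close> in the inner integral, which leaves \<open>H\<close> at the point
    \<open>\<pi> s\<close>, then \<open>f\<close> by \<open>F\<close> in the outer one. The second
    replacement needs \<open>\<bar>H x\<bar> \<le> 1\<close>.\<close>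
  define H where "H x = (\<integral>y. V (x, y) * G y \<partial>N)" for x
  have H[measurable]: "H \<in> borel_measurable N" unfolding H_def by measurable
  have H1: "\<bar>H x\<bar> \<le> 1" if [measurable]: "x \<in> space N" for x
  proof -
    have "\<bar>H x\<bar> \<le> (\<integral>y. \<bar>V (x, y) * G y\<bar> \<partial>N)"
      unfolding H_def by (rule integral_abs_bound)
    also have "\<dots> \<le> 1"
      using V1[OF that] G1 by (intro N.integral_le_const N.integrable_const_bound[where B=1] AE_I2)
        (auto simp: abs_mult mult_le_one)
    finally show ?thesis .
  qed
  have PV: "pullback V \<pi> \<in> borel_measurable (P \<Otimes>\<^sub>M P)"
    by (intro pullback_measurable[where M=N]) auto
  have "(\<integral>(s, t). pullback V \<pi> (s, t) * f s * g t \<partial>(P \<Otimes>\<^sub>M P)) =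
      (\<integral>s. (\<integral>t. pullback V \<pi> (s, t) * f s * g t \<partial>P) \<partial>P)"
    using V1 \<pi>_space f1 g1
    by (intro PP.integral_fst[symmetric, of "\<lambda>s t. pullback V \<pi> (s, t) * f s * g t"]
        P.integrable_cut_test[of "pullback V \<pi>"] PV) (auto simp: pullback_def)
  also have "\<dots> = (\<integral>s. H (\<pi> s) * f s \<partial>P)"
  proof (intro Bochner_Integration.integral_cong refl)
    fix s assume s: "s \<in> space P"
    have "(\<integral>t. pullback V \<pi> (s, t) * f s * g t \<partial>P) = (\<integral>t. f s * (V (\<pi> s, \<pi> t) * g t) \<partial>P)"
      by (simp add: pullback_def mult_ac)
    also have "\<dots> = f s * (\<integral>t. V (\<pi> s, \<pi> t) * g t \<partial>P)"
      by simp
    also have "(\<integral>t. V (\<pi> s, \<pi> t) * g t \<partial>P) = H (\<pi> s)"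
      unfolding H_def using V1 \<pi>_space[OF s] by (intro Gu) auto
    finally show "(\<integral>t. pullback V \<pi> (s, t) * f s * g t \<partial>P) = H (\<pi> s) * f s" by (simp add: mult_ac)
  qed
  also have "\<dots> = (\<integral>x. H x * F x \<partial>N)"
    by (rule Fu[OF H H1])
  also have "\<dots> = (\<integral>x. (\<integral>y. V (x, y) * F x * G y \<partial>N) \<partial>N)"
  proof (intro Bochner_Integration.integral_cong refl)
    fix x
    have "(\<integral>y. V (x, y) * F x * G y \<partial>N) = (\<integral>y. F x * (V (x, y) * G y) \<partial>N)"
      by (simp add: mult_ac)
    then show "H x * F x = (\<integral>y. V (x, y) * F x * G y \<partial>N)"
      by (simp add: H_def)
  qed
  also have "\<dots> = (\<integral>(x, y). V (x, y) * F x * G y \<partial>(N \<Otimes>\<^sub>M N))"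
    by (intro NN.integral_fst N.integrable_cut_test F G V V1 F1 G1)
  also have "\<bar>\<dots>\<bar> \<le> cut_norm N V"
    using F1 G1 by (intro cut_norm_upper[OF N V V1 F _ G]) (force simp: abs_le_iff)+
  finally show "\<bar>\<integral>(s, t). pullback V \<pi> (s, t) * f s * g t \<partial>(P \<Otimes>\<^sub>M P)\<bar> \<le> cut_norm N V" .
qed

subsection \<open>Approximation by step kernels\<close>

text \<open>A countable partition is encoded by the map \<open>p\<close> that sends a point to the
  index of its cell; the approximant has the value \<open>w i j\<close> on cell \<open>i\<close>
  times cell \<open>j\<close>. The same partition is used in both coordinates, so that agreement of
  cells of points suffices for agreement of the step kernel.\<close>

definition step_approximable :: "'a measure \<Rightarrow> ('a \<times> 'a \<Rightarrow> real) \<Rightarrow> bool" where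
  "step_approximable M f \<longleftrightarrow> (\<forall>e>0. \<exists>p w. p \<in> M \<rightarrow>\<^sub>M count_space (UNIV :: nat set) \<and>
     integrable (M \<Otimes>\<^sub>M M) (\<lambda>z. w (p (fst z)) (p (snd z))) \<and>
     (\<integral>z. \<bar>f z - w (p (fst z)) (p (snd z))\<bar> \<partial>(M \<Otimes>\<^sub>M M)) < e)"

lemma step_approximable_limit:
  assumes f[measurable]: "integrable (M \<Otimes>\<^sub>M M) f"
    and "\<And>e. e > 0 \<Longrightarrow> \<exists>g. integrable (M \<Otimes>\<^sub>M M) g \<and> step_approximable M g \<and>
      (\<integral>z. \<bar>f z - g z\<bar> \<partial>(M \<Otimes>\<^sub>M M)) < e"
  shows "step_approximable M f"
  unfolding step_approximable_def
proof (intro allI impI)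
  fix e :: real assume "e > 0"
  then obtain g where g[measurable]: "integrable (M \<Otimes>\<^sub>M M) g" and "step_approximable M g"
    and fg: "(\<integral>z. \<bar>f z - g z\<bar> \<partial>(M \<Otimes>\<^sub>M M)) < e / 2"
    using assms(2)[of "e / 2"] by auto
  then obtain p w where p: "p \<in> M \<rightarrow>\<^sub>M count_space (UNIV :: nat set)"
    and w: "integrable (M \<Otimes>\<^sub>M M) (\<lambda>z. w (p (fst z)) (p (snd z)))"
    and gw: "(\<integral>z. \<bar>g z - w (p (fst z)) (p (snd z))\<bar> \<partial>(M \<Otimes>\<^sub>M M)) < e / 2"
    unfolding step_approximable_def using \<open>e > 0\<close> by (meson half_gt_zero)
  have "(\<integral>z. \<bar>f z - w (p (fst z)) (p (snd z))\<bar> \<partial>(M \<Otimes>\<^sub>M M))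
      \<le> (\<integral>z. \<bar>f z - g z\<bar> + \<bar>g z - w (p (fst z)) (p (snd z))\<bar> \<partial>(M \<Otimes>\<^sub>M M))"
    using f g w by (intro integral_mono) auto
  also have "\<dots> < e"
    using f g w fg gw by (subst Bochner_Integration.integral_add) auto
  finally show "\<exists>p w. p \<in> M \<rightarrow>\<^sub>M count_space (UNIV :: nat set) \<and>
     integrable (M \<Otimes>\<^sub>M M) (\<lambda>z. w (p (fst z)) (p (snd z))) \<and>
     (\<integral>z. \<bar>f z - w (p (fst z)) (p (snd z))\<bar> \<partial>(M \<Otimes>\<^sub>M M)) < e"
    using p w by blast
qed

lemma step_approximable_add:
  assumes f: "integrable (M \<Otimes>\<^sub>M M) f" "step_approximable M f"
    and g: "integrable (M \<Otimes>\<^sub>M M) g" "step_approximable M g"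
  shows "step_approximable M (\<lambda>z. f z + g z)"
  unfolding step_approximable_def
proof (intro allI impI)
  fix e :: real assume "e > 0"
  obtain p w where p[measurable]: "p \<in> M \<rightarrow>\<^sub>M count_space (UNIV :: nat set)"
    and w: "integrable (M \<Otimes>\<^sub>M M) (\<lambda>z. w (p (fst z)) (p (snd z)))"
    and fw: "(\<integral>z. \<bar>f z - w (p (fst z)) (p (snd z))\<bar> \<partial>(M \<Otimes>\<^sub>M M)) < e / 2"
    using f(2) \<open>e > 0\<close> unfolding step_approximable_def by (meson half_gt_zero)
  obtain q v where q[measurable]: "q \<in> M \<rightarrow>\<^sub>M count_space (UNIV :: nat set)"
    and v: "integrable (M \<Otimes>\<^sub>M M) (\<lambda>z. v (q (fst z)) (q (snd z)))"
    and gv: "(\<integral>z. \<bar>g z - v (q (fst z)) (q (snd z))\<bar> \<partial>(M \<Otimes>\<^sub>M M)) < e / 2"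
    using g(2) \<open>e > 0\<close> unfolding step_approximable_def by (meson half_gt_zero)
  \<comment> \<open>\<open>r\<close> indexes the common refinement of the two partitions, and
    \<open>u\<close> recovers both cell indices from the code.\<close>
  define r where "r x = prod_encode (p x, q x)" for x
  define u where "u i j = w (fst (prod_decode i)) (fst (prod_decode j)) +
    v (snd (prod_decode i)) (snd (prod_decode j))" for i j
  have u: "u (r x) (r y) = w (p x) (p y) + v (q x) (q y)" for x y
    by (simp add: u_def r_def)
  have r: "r \<in> M \<rightarrow>\<^sub>M count_space UNIV" unfolding r_def by measurable
  have i: "integrable (M \<Otimes>\<^sub>M M) (\<lambda>z. u (r (fst z)) (r (snd z)))"
    using w v by (simp add: u)
  have "(\<integral>z. \<bar>f z + g z - u (r (fst z)) (r (snd z))\<bar> \<partial>(M \<Otimes>\<^sub>M M))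
      \<le> (\<integral>z. \<bar>f z - w (p (fst z)) (p (snd z))\<bar> + \<bar>g z - v (q (fst z)) (q (snd z))\<bar> \<partial>(M \<Otimes>\<^sub>M M))"
    using f g w v by (intro integral_mono) (auto simp: u)
  also have "\<dots> < e"
    using f g w v fw gv by (subst Bochner_Integration.integral_add) auto
  finally show "\<exists>p w. p \<in> M \<rightarrow>\<^sub>M count_space (UNIV :: nat set) \<and>
     integrable (M \<Otimes>\<^sub>M M) (\<lambda>z. w (p (fst z)) (p (snd z))) \<and>
     (\<integral>z. \<bar>f z + g z - w (p (fst z)) (p (snd z))\<bar> \<partial>(M \<Otimes>\<^sub>M M)) < e"
    using r i by blast
qed

lemma step_approximable_cmult:
  assumes f: "step_approximable M f"
  shows "step_approximable M (\<lambda>z. c * f z)"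
  unfolding step_approximable_def
proof (intro allI impI)
  fix e :: real assume "e > 0"
  \<comment> \<open>Adding 1 to the divisor covers the case \<open>c = 0\<close>.\<close>
  then have "e / (\<bar>c\<bar> + 1) > 0" by simp
  then obtain p w where p[measurable]: "p \<in> M \<rightarrow>\<^sub>M count_space (UNIV :: nat set)"
    and w: "integrable (M \<Otimes>\<^sub>M M) (\<lambda>z. w (p (fst z)) (p (snd z)))"
    and fw: "(\<integral>z. \<bar>f z - w (p (fst z)) (p (snd z))\<bar> \<partial>(M \<Otimes>\<^sub>M M)) < e / (\<bar>c\<bar> + 1)"
    using f unfolding step_approximable_def by meson
  have "(\<integral>z. \<bar>c * f z - c * w (p (fst z)) (p (snd z))\<bar> \<partial>(M \<Otimes>\<^sub>M M)) =
      \<bar>c\<bar> * (\<integral>z. \<bar>f z - w (p (fst z)) (p (snd z))\<bar> \<partial>(M \<Otimes>\<^sub>M M))"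
    by (subst integral_mult_right_zero[symmetric])
      (simp add: right_diff_distrib[symmetric] abs_mult)
  also have "\<dots> \<le> (\<bar>c\<bar> + 1) * (\<integral>z. \<bar>f z - w (p (fst z)) (p (snd z))\<bar> \<partial>(M \<Otimes>\<^sub>M M))"
    by (intro mult_right_mono) auto
  also have "\<dots> < e"
    using fw by (simp add: field_simps)
  finally have "(\<integral>z. \<bar>c * f z - c * w (p (fst z)) (p (snd z))\<bar> \<partial>(M \<Otimes>\<^sub>M M)) < e" .
  moreover have "integrable (M \<Otimes>\<^sub>M M) (\<lambda>z. c * w (p (fst z)) (p (snd z)))"
    using w by simp
  ultimately show "\<exists>p w. p \<in> M \<rightarrow>\<^sub>M count_space (UNIV :: nat set) \<and>
     integrable (M \<Otimes>\<^sub>M M) (\<lambda>z. w (p (fst z)) (p (snd z))) \<and>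
     (\<integral>z. \<bar>c * f z - w (p (fst z)) (p (snd z))\<bar> \<partial>(M \<Otimes>\<^sub>M M)) < e"
    using p by (intro exI[of _ p] exI[of _ "\<lambda>i j. c * w i j"]) auto
qed

lemma step_approximable_cong:
  assumes "\<And>z. z \<in> space (M \<Otimes>\<^sub>M M) \<Longrightarrow> f z = g z"
  shows "step_approximable M f \<longleftrightarrow> step_approximable M g"
  unfolding step_approximable_def by (simp add: assms cong: Bochner_Integration.integral_cong)

lemma (in prob_space) step_approximable_rectangle:
  assumes [measurable]: "A \<in> sets M" "B \<in> sets M"
  shows "step_approximable M (indicator (A \<times> B))"
  unfolding step_approximable_def
proof (intro allI impI)
  interpret MM: pair_prob_space M M ..
  fix e :: real assume "e > 0"
  \<comment> \<open>\<open>p\<close> stores membership in \<open>A\<close> and in \<open>B\<close>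
    as two binary digits; \<open>i \<ge> 2\<close> reads the first and \<open>odd j\<close> the
    second. The rectangle is therefore a step function itself, with error 0.\<close>
  define p :: "'a \<Rightarrow> nat" where "p x = (if x \<in> A then 2 else 0) + (if x \<in> B then 1 else 0)" for x
  define w :: "nat \<Rightarrow> nat \<Rightarrow> real" where "w i j = (if i \<ge> 2 \<and> odd j then 1 else 0)" for i j
  have "p \<in> M \<rightarrow>\<^sub>M count_space UNIV" unfolding p_def by measurable
  moreover have "(\<lambda>z. w (p (fst z)) (p (snd z))) = indicator (A \<times> B)"
    by (auto simp: fun_eq_iff w_def p_def indicator_def)
  moreover have "integrable (M \<Otimes>\<^sub>M M) (indicator (A \<times> B) :: _ \<Rightarrow> real)"
    by (auto simp: MM.emeasure_eq_measure less_top[symmetric])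
  ultimately show "\<exists>p w. p \<in> M \<rightarrow>\<^sub>M count_space (UNIV :: nat set) \<and>
     integrable (M \<Otimes>\<^sub>M M) (\<lambda>z. w (p (fst z)) (p (snd z))) \<and>
     (\<integral>z. \<bar>indicator (A \<times> B) z - w (p (fst z)) (p (snd z))\<bar> \<partial>(M \<Otimes>\<^sub>M M)) < e"
    using \<open>e > 0\<close> by (intro exI[of _ p] exI[of _ w]) (simp add: fun_eq_iff)
qed

text \<open>Dominated convergence with majorant \<open>3 * \<bar>f z\<bar>\<close> turns the
  pointwise limit into an L1 limit. The factor 2 in the bound is the one that
  \<open>integrable_induct\<close> provides.\<close>

lemma (in prob_space) step_approximable_dominated_limit:
  fixes f :: "'a \<times> 'a \<Rightarrow> real"
  assumes f: "integrable (M \<Otimes>\<^sub>M M) f"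
    and s: "\<And>i :: nat. integrable (M \<Otimes>\<^sub>M M) (s i)" "\<And>i. step_approximable M (s i)"
    and lim: "\<And>z. z \<in> space (M \<Otimes>\<^sub>M M) \<Longrightarrow> (\<lambda>i. s i z) \<longlonglongrightarrow> f z"
    and bd: "\<And>i z. z \<in> space (M \<Otimes>\<^sub>M M) \<Longrightarrow> \<bar>s i z\<bar> \<le> 2 * \<bar>f z\<bar>"
  shows "step_approximable M f"
proof (rule step_approximable_limit[OF f])
  fix e :: real assume "e > 0"
  have "(\<lambda>i. \<integral>z. \<bar>f z - s i z\<bar> \<partial>(M \<Otimes>\<^sub>M M)) \<longlonglongrightarrow> (\<integral>z. 0 \<partial>(M \<Otimes>\<^sub>M M))"
  proof (rule integral_dominated_convergence[where w="\<lambda>z. 3 * \<bar>f z\<bar>"])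
    show "AE z in M \<Otimes>\<^sub>M M. (\<lambda>i. \<bar>f z - s i z\<bar>) \<longlonglongrightarrow> 0"
    proof (rule AE_I2)
      fix z assume "z \<in> space (M \<Otimes>\<^sub>M M)"
      from tendsto_rabs[OF tendsto_diff[OF tendsto_const lim[OF this], of "f z"]]
      show "(\<lambda>i. \<bar>f z - s i z\<bar>) \<longlonglongrightarrow> 0" by simp
    qed
    show "AE z in M \<Otimes>\<^sub>M M. norm \<bar>f z - s i z\<bar> \<le> 3 * \<bar>f z\<bar>" for i
      using bd[of _ i] by (intro AE_I2) (smt (verit) real_norm_def)
  qed (use f s in auto)
  then have "eventually (\<lambda>i. (\<integral>z. \<bar>f z - s i z\<bar> \<partial>(M \<Otimes>\<^sub>M M)) < e) sequentially"
    using \<open>e > 0\<close> by (intro order_tendstoD(2)) auto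
  then show "\<exists>g. integrable (M \<Otimes>\<^sub>M M) g \<and> step_approximable M g \<and> (\<integral>z. \<bar>f z - g z\<bar> \<partial>(M \<Otimes>\<^sub>M M)) < e"
    using s eventually_happens'[OF sequentially_bot] by blast
qed

text \<open>Dynkin's argument: rectangles form an intersection-stable generator, and the sets with
  approximable indicator are closed under complements and countable disjoint unions.\<close>

lemma (in prob_space) step_approximable_indicator:
  assumes "Q \<in> sets (M \<Otimes>\<^sub>M M)"
  shows "step_approximable M (indicator Q)"
proof -
  interpret MM: pair_prob_space M M ..
  have ii: "integrable (M \<Otimes>\<^sub>M M) (indicator Q :: _ \<Rightarrow> real)" if "Q \<in> sets (M \<Otimes>\<^sub>M M)" for Q
    using that by (auto simp: MM.emeasure_eq_measure less_top[symmetric])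
  let ?R = "{A \<times> B |A B. A \<in> sets M \<and> B \<in> sets M}"
  have R: "sigma_sets (space M \<times> space M) ?R = sets (M \<Otimes>\<^sub>M M)"
    by (simp add: sets_pair_measure)
  have Rsub: "?R \<subseteq> Pow (space M \<times> space M)" using sets.sets_into_space by fast
  have "Q \<in> sigma_sets (space M \<times> space M) ?R" using assms R by simp
  from Int_stable_pair_measure_generator Rsub this show ?thesis
  proof (induction rule: sigma_sets_induct_disjoint)
    case (basic A) then show ?case by (auto intro: step_approximable_rectangle)
  next
    case empty
    show ?case using step_approximable_rectangle[of "{}" "{}"] by (simp add: indicator_def[abs_def])
  next
    case (compl A)
    then have A: "A \<in> sets (M \<Otimes>\<^sub>M M)" using R by simp
    have "step_approximable M (\<lambda>z. indicator (space M \<times> space M) z + (-1) * indicator A z)"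
      using A compl ii[OF A] ii[OF sets.top] by (intro step_approximable_add step_approximable_rectangle step_approximable_cmult)
        (auto simp: space_pair_measure)
    then show ?case
      by (rule step_approximable_cong[THEN iffD1, rotated])
        (use sets.sets_into_space[OF A] in \<open>auto simp: indicator_def space_pair_measure\<close>)
  next
    case (union A)
    then have A: "A i \<in> sets (M \<Otimes>\<^sub>M M)" for i using R by auto
    \<comment> \<open>The partial unions. Disjointness turns each further set into an added
      indicator, so each \<open>s n\<close> is approximable by induction, and the full union is
      their dominated limit.\<close>
    define s :: "nat \<Rightarrow> _ \<Rightarrow> real" where "s n = indicator (\<Union>i<n. A i)" for n
    have sS: "s (Suc n) = (\<lambda>z. s n z + indicator (A n) z)" for n
    proof
      fix z
      have "A i \<inter> A n = {}" if "i < n" for i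
        using union(1) that by (auto simp: disjoint_family_on_def)
      then show "s (Suc n) z = s n z + indicator (A n) z"
        by (auto simp: s_def lessThan_Suc indicator_def)
    qed
    have si: "integrable (M \<Otimes>\<^sub>M M) (s n)" for n
      unfolding s_def using A by (intro ii) auto
    have sa: "step_approximable M (s n)" for n
    proof (induction n)
      case 0 show ?case using step_approximable_rectangle[of "{}" "{}"] by (simp add: s_def indicator_def[abs_def])
    next
      case (Suc n) then show ?case
        unfolding sS using union(3) A si ii by (intro step_approximable_add) auto
    qed
    show ?case
    proof (rule step_approximable_dominated_limit[of _ s])
      show "integrable (M \<Otimes>\<^sub>M M) (indicator (\<Union> (range A)) :: _ \<Rightarrow> real)"
        using A by (intro ii) auto
      show "(\<lambda>i. s i z) \<longlonglongrightarrow> indicator (\<Union> (range A)) z" for z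
        unfolding s_def by (rule LIMSEQ_indicator_UN)
      show "\<bar>s i z\<bar> \<le> 2 * \<bar>indicator (\<Union> (range A)) z\<bar>" for i z
        by (auto simp: s_def indicator_def)
    qed (auto simp: si sa)
  qed
qed

lemma (in prob_space) step_approximable_integrable:
  assumes "integrable (M \<Otimes>\<^sub>M M) f"
  shows "step_approximable M f"
  using assms
proof (induction rule: integrable_induct)
  case (base A c)
  then show ?case
    using step_approximable_cmult[OF step_approximable_indicator[OF base(1)], of c]
    by (simp add: mult.commute)
next
  case (add f g)
  then show ?case by (intro step_approximable_add)
next
  case (lim f s)
  then show ?case by (intro step_approximable_dominated_limit[of f s]) auto
qed

subsection \<open>The triangle inequality for the cut distance\<close>

text \<open>Tonelli on cylinders over \<open>A\<close>: the inner integral of the density along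
  almost every fibre is 1, so only the measure of the base \<open>A\<close> remains.\<close>

lemma distr_fst_density:
  assumes N1: "prob_space N1" and N2: "prob_space N2" and k[measurable]: "k \<in> borel_measurable (N1 \<Otimes>\<^sub>M N2)"
    and k1: "AE x in N1. (\<integral>\<^sup>+y. k (x, y) \<partial>N2) = 1"
  shows "distr (density (N1 \<Otimes>\<^sub>M N2) k) N1 fst = N1"
proof (rule measure_eqI)
  interpret N1: prob_space N1 by fact
  interpret N2: prob_space N2 by fact
  interpret pair_prob_space N1 N2 ..
  fix A assume "A \<in> sets (distr (density (N1 \<Otimes>\<^sub>M N2) k) N1 fst)"
  then have A[measurable]: "A \<in> sets N1" by simp
  have "emeasure (distr (density (N1 \<Otimes>\<^sub>M N2) k) N1 fst) A =
      (\<integral>\<^sup>+z. k z * indicator A (fst z) \<partial>(N1 \<Otimes>\<^sub>M N2))"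
    by (subst emeasure_distr) (auto simp: emeasure_density indicator_def intro!: nn_integral_cong)
  also have "\<dots> = (\<integral>\<^sup>+x. (\<integral>\<^sup>+y. k (x, y) * indicator A x \<partial>N2) \<partial>N1)"
    by (subst N2.nn_integral_fst[symmetric]) auto
  also have "\<dots> = (\<integral>\<^sup>+x. indicator A x \<partial>N1)"
    using k1 by (intro nn_integral_cong_AE) (auto simp: nn_integral_multc)
  finally show "emeasure (distr (density (N1 \<Otimes>\<^sub>M N2) k) N1 fst) A = emeasure N1 A" by simp
qed simp

lemma distr_snd_density:
  assumes N1: "prob_space N1" and N2: "prob_space N2" and k[measurable]: "k \<in> borel_measurable (N1 \<Otimes>\<^sub>M N2)"
    and k1: "AE y in N2. (\<integral>\<^sup>+x. k (x, y) \<partial>N1) = 1"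
  shows "distr (density (N1 \<Otimes>\<^sub>M N2) k) N2 snd = N2"
proof (rule measure_eqI)
  interpret N1: prob_space N1 by fact
  interpret N2: prob_space N2 by fact
  interpret pair_prob_space N1 N2 ..
  fix A assume "A \<in> sets (distr (density (N1 \<Otimes>\<^sub>M N2) k) N2 snd)"
  then have A[measurable]: "A \<in> sets N2" by simp
  have "emeasure (distr (density (N1 \<Otimes>\<^sub>M N2) k) N2 snd) A =
      (\<integral>\<^sup>+z. k z * indicator A (snd z) \<partial>(N1 \<Otimes>\<^sub>M N2))"
    by (subst emeasure_distr) (auto simp: emeasure_density indicator_def intro!: nn_integral_cong)
  also have "\<dots> = (\<integral>\<^sup>+y. (\<integral>\<^sup>+x. k (x, y) * indicator A y \<partial>N1) \<partial>N2)"
    by (subst nn_integral_snd[symmetric]) auto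
  also have "\<dots> = (\<integral>\<^sup>+y. indicator A y \<partial>N2)"
    using k1 by (intro nn_integral_cong_AE) (auto simp: nn_integral_multc)
  finally show "emeasure (distr (density (N1 \<Otimes>\<^sub>M N2) k) N2 snd) A = emeasure N2 A" by simp
qed simp

lemma AE_measure_preserving:
  assumes "\<phi> \<in> measure_preserving N M" "AE x in M. Q x"
  shows "AE x in N. Q (\<phi> x)"
proof (rule AE_distrD[OF measure_preservingD(1)[OF assms(1)]])
  show "AE x in distr N M \<phi>. Q x"
    unfolding measure_preservingD(2)[OF assms(1)] by fact
qed

text \<open>The two couplings are made conditionally independent given the cell of the countable
  partition \<open>p\<close> that contains their common coordinate; unlike an exact gluing along that coordinate,
  this needs no disintegration of measures.\<close>

lemma glue_along_partition:
  fixes N1 :: "'a measure" and N2 :: "'b measure" and M :: "'c measure"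
  assumes N1: "prob_space N1" and N2: "prob_space N2"
    and \<phi>: "\<phi> \<in> measure_preserving N1 M" and \<psi>: "\<psi> \<in> measure_preserving N2 M"
    and p[measurable]: "p \<in> M \<rightarrow>\<^sub>M count_space (UNIV :: nat set)"
  obtains P :: "('a \<times> 'b) measure" where "prob_space P"
    "fst \<in> measure_preserving P N1" "snd \<in> measure_preserving P N2"
    "AE s in P. p (\<phi> (fst s)) = p (\<psi> (snd s))"
proof -
  interpret N1: prob_space N1 by fact
  interpret N2: prob_space N2 by fact
  interpret M: prob_space M by (rule measure_preserving_prob_space[OF \<phi> N1])
  note [measurable] = measure_preservingD(1)[OF \<phi>] measure_preservingD(1)[OF \<psi>]
  define m where "m i = measure M {z \<in> space M. p z = i}" for i
  \<comment> \<open>The pairs whose coordinates both lie in cell \<open>i\<close> form a block of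
    product measure \<open>m i\<close> squared. The weight \<open>1 / m i\<close> reduces this to
    \<open>m i\<close>, which is what both marginals need. On null cells the weight is 0, as
    division by 0 gives 0.\<close>
  define k where "k z = ennreal (if p (\<phi> (fst z)) = p (\<psi> (snd z)) then 1 / m (p (\<phi> (fst z))) else 0)" for z
  have mm: "(\<lambda>z. m (p (\<phi> (fst z)))) \<in> borel_measurable (N1 \<Otimes>\<^sub>M N2)"
    by (rule measurable_compose[of "\<lambda>z. p (\<phi> (fst z))" _ "count_space UNIV"]) auto
  \<comment> \<open>The event that both coordinates lie in one cell is written as a countable union
    over the common index, which makes its measurability evident.\<close>
  have "Measurable.pred (N1 \<Otimes>\<^sub>M N2) (\<lambda>z. \<exists>i. p (\<phi> (fst z)) = i \<and> p (\<psi> (snd z)) = i)"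
    by measurable
  then have [measurable]: "Measurable.pred (N1 \<Otimes>\<^sub>M N2) (\<lambda>z. p (\<phi> (fst z)) = p (\<psi> (snd z)))"
    by (simp add: eq_commute[of "p (\<phi> _)"])
  have k[measurable]: "k \<in> borel_measurable (N1 \<Otimes>\<^sub>M N2)" 
    unfolding k_def by (intro measurable_compose[OF _ measurable_ennreal] measurable_If
        borel_measurable_divide borel_measurable_const mm) measurable
  have cell: "emeasure N {x \<in> space N. p (f x) = i} = ennreal (m i)"
    if f: "f \<in> measure_preserving N M" for f :: "'d \<Rightarrow> 'c" and N i
  proof -
    note [measurable] = measure_preservingD(1)[OF f]
    have "ennreal (m i) = emeasure (distr N M f) {z \<in> space M. p z = i}"
      by (simp add: m_def M.emeasure_eq_measure measure_preservingD(2)[OF f])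
    also have "\<dots> = emeasure N {x \<in> space N. p (f x) = i}"
      by (subst emeasure_distr) (auto intro!: arg_cong[where f="emeasure N"]
          dest: measurable_space[OF measure_preservingD(1)[OF f]])
    finally show ?thesis by simp
  qed
  have m_inverse: "ennreal (1 / m i) * ennreal (m i) = 1" if "m i \<noteq> 0" for i
    using that by (subst ennreal_mult[symmetric]) (auto simp: m_def)
  \<comment> \<open>There are countably many null cells, so together they are null and almost every
    point lies in a cell where the weight is meaningful.\<close>
  have m_pos: "AE z in M. m (p z) \<noteq> 0"
  proof -
    have "AE z in M. \<forall>i. m i = 0 \<longrightarrow> p z \<noteq> i"
      unfolding AE_all_countable
    proof
      fix i
      show "AE z in M. m i = 0 \<longrightarrow> p z \<noteq> i"
      proof (cases "m i = 0")
        case True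
        then have "AE z in M. z \<notin> {z \<in> space M. p z = i}"
          unfolding m_def by (subst (asm) M.prob_eq_0) auto
        with AE_space show ?thesis by eventually_elim auto
      qed auto
    qed
    then show ?thesis by eventually_elim auto
  qed
  have k1: "AE x in N1. (\<integral>\<^sup>+y. k (x, y) \<partial>N2) = 1"
    using AE_measure_preserving[OF \<phi> m_pos]
  proof eventually_elim
    case (elim x)
    have "(\<integral>\<^sup>+y. k (x, y) \<partial>N2) =
        (\<integral>\<^sup>+y. ennreal (1 / m (p (\<phi> x))) * indicator {y \<in> space N2. p (\<psi> y) = p (\<phi> x)} y \<partial>N2)"
      by (intro nn_integral_cong) (auto simp: k_def indicator_def)
    also have "\<dots> = ennreal (1 / m (p (\<phi> x))) * emeasure N2 {y \<in> space N2. p (\<psi> y) = p (\<phi> x)}"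
      by (subst nn_integral_cmult_indicator) auto
    finally show ?case unfolding cell[OF \<psi>] m_inverse[OF elim] .
  qed
  have k2: "AE y in N2. (\<integral>\<^sup>+x. k (x, y) \<partial>N1) = 1"
    using AE_measure_preserving[OF \<psi> m_pos]
  proof eventually_elim
    case (elim y)
    have "(\<integral>\<^sup>+x. k (x, y) \<partial>N1) =
        (\<integral>\<^sup>+x. ennreal (1 / m (p (\<psi> y))) * indicator {x \<in> space N1. p (\<phi> x) = p (\<psi> y)} x \<partial>N1)"
      by (intro nn_integral_cong) (auto simp: k_def indicator_def)
    also have "\<dots> = ennreal (1 / m (p (\<psi> y))) * emeasure N1 {x \<in> space N1. p (\<phi> x) = p (\<psi> y)}"
      by (subst nn_integral_cmult_indicator) auto
    finally show ?case unfolding cell[OF \<phi>] m_inverse[OF elim] .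
  qed
  define P where "P = density (N1 \<Otimes>\<^sub>M N2) k"
  have fst: "distr P N1 fst = N1" and snd: "distr P N2 snd = N2"
    unfolding P_def using distr_fst_density[OF N1 N2 k k1] distr_snd_density[OF N1 N2 k k2] by auto
  have [measurable]: "fst \<in> P \<rightarrow>\<^sub>M N1" "snd \<in> P \<rightarrow>\<^sub>M N2" by (auto simp: P_def)
  show ?thesis
  proof (rule that[of P])
    \<comment> \<open>The total mass of \<open>P\<close> is read off its first marginal.\<close>
    show "prob_space P"
      using N1 by (intro prob_space_distrD[of fst P N1]) (auto simp: fst)
    show "fst \<in> measure_preserving P N1" "snd \<in> measure_preserving P N2"
      by (auto simp: measure_preserving_def fst snd)
    show "AE s in P. p (\<phi> (fst s)) = p (\<psi> (snd s))"
      unfolding P_def by (subst AE_density) (auto simp: k_def split: if_splits)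
  qed
qed

section \<open>Elementary properties of the cut distance\<close>

text \<open>The independent coupling, obtained from the marginal lemmas with constant density
  1.\<close>

lemma product_coupling:
  assumes "prob_space M1" "prob_space M2"
  shows "fst \<in> measure_preserving (M1 \<Otimes>\<^sub>M M2) M1" "snd \<in> measure_preserving (M1 \<Otimes>\<^sub>M M2) M2"
  using distr_fst_density[OF assms, of "\<lambda>_. 1"] distr_snd_density[OF assms, of "\<lambda>_. 1"] assms
  by (auto simp: measure_preserving_def density_1 prob_space.emeasure_space_1)

text \<open>Needed because the \<open>Inf\<close> of the empty set of reals carries no information;
  the product measure supplies a coupling.\<close>

lemma cut_distance_nonempty:
  assumes "prob_space M1" "prob_space M2"
  shows "{cut_norm N (\<lambda>z. pullback W1 \<phi>1 z - pullback W2 \<phi>2 z) | (N :: ('a \<times> 'b) measure) \<phi>1 \<phi>2.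
       prob_space N \<and> \<phi>1 \<in> measure_preserving N (M1 :: 'a measure) \<and>
       \<phi>2 \<in> measure_preserving N (M2 :: 'b measure)} \<noteq> {}"
proof -
  interpret M1: prob_space M1 by fact
  interpret M2: prob_space M2 by fact
  interpret pair_prob_space M1 M2 ..
  show ?thesis using product_coupling[OF assms] prob_space_axioms by blast
qed

lemma cut_distance_nonneg:
  assumes "prob_space M1" "prob_space M2" "W1 \<in> kernels M1" "W2 \<in> kernels M2"
  shows "0 \<le> cut_distance M1 W1 M2 W2"
  unfolding cut_distance_def
  using assms by (intro cInf_greatest cut_distance_nonempty) (auto intro!: cut_norm_nonneg pullback_diff)

lemma coupling_below:
  fixes M1 :: "'a measure" and M2 :: "'b measure"
  assumes "prob_space M1" "prob_space M2" "cut_distance M1 W1 M2 W2 < c"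
  obtains N :: "('a \<times> 'b) measure" and \<phi>1 \<phi>2 where "prob_space N"
    "\<phi>1 \<in> measure_preserving N M1" "\<phi>2 \<in> measure_preserving N M2"
    "cut_norm N (\<lambda>z. pullback W1 \<phi>1 z - pullback W2 \<phi>2 z) < c"
  using cInf_lessD[OF cut_distance_nonempty[OF assms(1,2)] assms(3)[unfolded cut_distance_def]] by blast

lemma cut_distance_commute:
  fixes M1 :: "'a measure" and M2 :: "'b measure"
  assumes M: "prob_space M1" "prob_space M2" and W: "W1 \<in> kernels M1" "W2 \<in> kernels M2"
  shows "cut_distance M1 W1 M2 W2 = cut_distance M2 W2 M1 W1"
proof -
  \<comment> \<open>The two infima range over measures on different types, and
    \<open>cut_distance_le\<close> carries a near-optimal coupling from one to the other. With type
    variables of its own, the inequality can be used in both directions.\<close>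
  have le: "cut_distance M1 W1 M2 W2 \<le> cut_distance M2 W2 M1 W1"
    if M: "prob_space M1" "prob_space M2" and W: "W1 \<in> kernels M1" "W2 \<in> kernels M2"
    for M1 :: "'c measure" and M2 :: "'d measure" and W1 W2
  proof (rule field_le_epsilon)
    fix e :: real assume "e > 0"
    then obtain N :: "('d \<times> 'c) measure" and \<phi>2 \<phi>1 where N: "prob_space N"
      and \<phi>: "\<phi>2 \<in> measure_preserving N M2" "\<phi>1 \<in> measure_preserving N M1"
      and lt: "cut_norm N (\<lambda>z. pullback W2 \<phi>2 z - pullback W1 \<phi>1 z) < cut_distance M2 W2 M1 W1 + e"
      using coupling_below[OF M(2,1), of W2 W1 "cut_distance M2 W2 M1 W1 + e"] by auto
    have "cut_distance M1 W1 M2 W2 \<le> cut_norm N (\<lambda>z. pullback W1 \<phi>1 z - pullback W2 \<phi>2 z)"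
      by (rule cut_distance_le[OF N W \<phi>(2,1)])
    also have "\<dots> = cut_norm N (\<lambda>z. pullback W2 \<phi>2 z - pullback W1 \<phi>1 z)"
      by (subst cut_norm_minus[symmetric]) simp
    finally show "cut_distance M1 W1 M2 W2 \<le> cut_distance M2 W2 M1 W1 + e" using lt by simp
  qed
  show ?thesis using le[OF M W] le[OF M(2,1) W(2,1)] by simp
qed

text \<open>The identity in both places is a coupling, and the cut norm is at most the L1
  norm.\<close>

lemma cut_distance_le_L1:
  assumes M: "prob_space M" and W: "W1 \<in> kernels M" "W2 \<in> kernels M"
  shows "cut_distance M W1 M W2 \<le> (\<integral>z. \<bar>W1 z - W2 z\<bar> \<partial>(M \<Otimes>\<^sub>M M))"
proof -
  have id: "(\<lambda>x. x) \<in> measure_preserving M M"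
    by (simp add: measure_preserving_def distr_id2)
  have "cut_distance M W1 M W2 \<le> cut_norm M (\<lambda>z. pullback W1 (\<lambda>x. x) z - pullback W2 (\<lambda>x. x) z)"
    by (rule cut_distance_le[OF M W id id])
  also have "\<dots> \<le> (\<integral>z. \<bar>pullback W1 (\<lambda>x. x) z - pullback W2 (\<lambda>x. x) z\<bar> \<partial>(M \<Otimes>\<^sub>M M))"
    by (intro prob_space.cut_norm_le_L1 M pullback_diff[OF M W id id])
  also have "\<dots> = (\<integral>z. \<bar>W1 z - W2 z\<bar> \<partial>(M \<Otimes>\<^sub>M M))"
    by (simp add: pullback_def split_beta')
  finally show ?thesis .
qed

lemma cut_distance_triangle:
  fixes M1 :: "'a measure" and M2 :: "'b measure" and M3 :: "'c measure"
  assumes M: "prob_space M1" "prob_space M2" "prob_space M3"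
    and W1: "W1 \<in> kernels M1" and W2: "W2 \<in> kernels M2" and W3: "W3 \<in> kernels M3"
  shows "cut_distance M1 W1 M3 W3 \<le> cut_distance M1 W1 M2 W2 + cut_distance M2 W2 M3 W3"
proof (rule field_le_epsilon)
  fix e :: real assume "e > 0"
  interpret M2: prob_space M2 by fact
  interpret M22: pair_prob_space M2 M2 ..
  \<comment> \<open>The error \<open>e\<close> is spent in quarters: one on each of the two
    near-optimal couplings, and one on each of the two pullbacks of the step approximation of
    \<open>W2\<close>.\<close>
  obtain N :: "('a \<times> 'b) measure" and \<phi>1 \<phi>2 where N: "prob_space N"
    and \<phi>: "\<phi>1 \<in> measure_preserving N M1" "\<phi>2 \<in> measure_preserving N M2"
    and ltN: "cut_norm N (\<lambda>z. pullback W1 \<phi>1 z - pullback W2 \<phi>2 z) < cut_distance M1 W1 M2 W2 + e / 4"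
    using coupling_below[OF M(1,2), of W1 W2 "cut_distance M1 W1 M2 W2 + e / 4"] \<open>e > 0\<close> by auto
  obtain K :: "('b \<times> 'c) measure" and \<psi>2 \<psi>3 where K: "prob_space K"
    and \<psi>: "\<psi>2 \<in> measure_preserving K M2" "\<psi>3 \<in> measure_preserving K M3"
    and ltK: "cut_norm K (\<lambda>z. pullback W2 \<psi>2 z - pullback W3 \<psi>3 z) < cut_distance M2 W2 M3 W3 + e / 4"
    using coupling_below[OF M(2,3), of W2 W3 "cut_distance M2 W2 M3 W3 + e / 4"] \<open>e > 0\<close> by auto
  have W2m[measurable]: "W2 \<in> borel_measurable (M2 \<Otimes>\<^sub>M M2)" by (rule kernelsD(1)[OF W2])
  have W2i: "integrable (M2 \<Otimes>\<^sub>M M2) W2"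
    using kernelsD(3,4)[OF W2]
    by (intro M22.integrable_const_bound[where B=1] AE_I2) (auto simp: space_pair_measure)
  obtain p w where p[measurable]: "p \<in> M2 \<rightarrow>\<^sub>M count_space (UNIV :: nat set)"
    and w: "integrable (M2 \<Otimes>\<^sub>M M2) (\<lambda>z. w (p (fst z)) (p (snd z)))"
    and ltw: "(\<integral>z. \<bar>W2 z - w (p (fst z)) (p (snd z))\<bar> \<partial>(M2 \<Otimes>\<^sub>M M2)) < e / 4"
    using M2.step_approximable_integrable[OF W2i] \<open>e > 0\<close>
    unfolding step_approximable_def by (meson zero_less_divide_iff zero_less_numeral)
  obtain P :: "(('a \<times> 'b) \<times> ('b \<times> 'c)) measure" where P: "prob_space P"
    and fst: "fst \<in> measure_preserving P N" and snd: "snd \<in> measure_preserving P K"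
    and eq: "AE s in P. p (\<phi>2 (fst s)) = p (\<psi>2 (snd s))"
    using glue_along_partition[OF N K \<phi>(2) \<psi>(1) p] by blast
  interpret P: prob_space P by fact
  interpret PP: pair_prob_space P P ..
  \<comment> \<open>\<open>\<alpha>2\<close> and \<open>\<beta>2\<close> are the two copies of the
    middle coordinate on \<open>P\<close>. They may differ, but almost surely they lie in the same
    cell of \<open>p\<close>; the term \<open>B\<close> below measures the discrepancy this causes
    in \<open>W2\<close>.\<close>
  define \<alpha>1 where "\<alpha>1 s = \<phi>1 (fst s)" for s :: "('a \<times> 'b) \<times> ('b \<times> 'c)"
  define \<alpha>2 where "\<alpha>2 s = \<phi>2 (fst s)" for s :: "('a \<times> 'b) \<times> ('b \<times> 'c)"
  define \<beta>2 where "\<beta>2 s = \<psi>2 (snd s)" for s :: "('a \<times> 'b) \<times> ('b \<times> 'c)"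
  define \<beta>3 where "\<beta>3 s = \<psi>3 (snd s)" for s :: "('a \<times> 'b) \<times> ('b \<times> 'c)"
  have \<alpha>: "\<alpha>1 \<in> measure_preserving P M1" "\<alpha>2 \<in> measure_preserving P M2"
    and \<beta>: "\<beta>2 \<in> measure_preserving P M2" "\<beta>3 \<in> measure_preserving P M3"
    unfolding \<alpha>1_def \<alpha>2_def \<beta>2_def \<beta>3_def using fst snd \<phi> \<psi> by (auto intro: measure_preserving_comp)
  note [measurable] = measure_preservingD(1)[OF \<alpha>(2)] measure_preservingD(1)[OF \<beta>(1)]
  define A where "A z = pullback W1 \<alpha>1 z - pullback W2 \<alpha>2 z" for z
  define B where "B z = pullback W2 \<alpha>2 z - pullback W2 \<beta>2 z" for z
  define C where "C z = pullback W2 \<beta>2 z - pullback W3 \<beta>3 z" for z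
  have A: "cut_norm P A \<le> cut_norm N (\<lambda>z. pullback W1 \<phi>1 z - pullback W2 \<phi>2 z)"
    using cut_norm_pullback_le[OF P fst pullback_diff[OF N W1 W2 \<phi>]]
    unfolding A_def by (simp add: pullback_def \<alpha>1_def \<alpha>2_def split_beta')
  have C: "cut_norm P C \<le> cut_norm K (\<lambda>z. pullback W2 \<psi>2 z - pullback W3 \<psi>3 z)"
    using cut_norm_pullback_le[OF P snd pullback_diff[OF K W2 W3 \<psi>]]
    unfolding C_def by (simp add: pullback_def \<beta>2_def \<beta>3_def split_beta')
  define D where "D z = W2 z - w (p (fst z)) (p (snd z))" for z
  have D: "integrable (M2 \<Otimes>\<^sub>M M2) D" unfolding D_def using W2i w by auto
  have Dp: "integrable (P \<Otimes>\<^sub>M P) (pullback D \<gamma>)"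
      "(\<integral>z. \<bar>pullback D \<gamma> z\<bar> \<partial>(P \<Otimes>\<^sub>M P)) < e / 4"
    if \<gamma>: "\<gamma> \<in> measure_preserving P M2" for \<gamma>
  proof -
    note \<gamma>\<gamma> = measure_preserving_pair[OF P \<gamma>]
    show "integrable (P \<Otimes>\<^sub>M P) (pullback D \<gamma>)"
      using integrable_distr[OF measure_preservingD(1)[OF \<gamma>\<gamma>], of D,
          unfolded measure_preservingD(2)[OF \<gamma>\<gamma>]] D
      by (simp add: pullback_def split_beta')
    show "(\<integral>z. \<bar>pullback D \<gamma> z\<bar> \<partial>(P \<Otimes>\<^sub>M P)) < e / 4"
      using integral_measure_preserving[OF \<gamma>\<gamma>, of "\<lambda>z. \<bar>D z\<bar>"] D ltw
      by (simp add: pullback_def split_beta' D_def)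
  qed
  have "cut_norm P B \<le> (\<integral>z. \<bar>B z\<bar> \<partial>(P \<Otimes>\<^sub>M P))"
    unfolding B_def by (intro P.cut_norm_le_L1 pullback_diff[OF P W2 W2 \<alpha>(2) \<beta>(1)])
  also have "\<dots> \<le> (\<integral>z. \<bar>pullback D \<alpha>2 z\<bar> + \<bar>pullback D \<beta>2 z\<bar> \<partial>(P \<Otimes>\<^sub>M P))"
  proof (rule integral_mono_AE)
    show "integrable (P \<Otimes>\<^sub>M P) (\<lambda>z. \<bar>B z\<bar>)"
      unfolding B_def using pullback_diff[OF P W2 W2 \<alpha>(2) \<beta>(1)]
      by (intro integrable_abs PP.integrable_const_bound[where B=1] AE_I2) (auto simp: space_pair_measure)
    \<comment> \<open>Off a null set both points of the pair have matching cells, so the step kernel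
      takes equal values along \<open>\<alpha>2\<close> and \<open>\<beta>2\<close> and cancels from
      \<open>B\<close>. Only the two approximation errors are left.\<close>
    show "AE z in P \<Otimes>\<^sub>M P. \<bar>B z\<bar> \<le> \<bar>pullback D \<alpha>2 z\<bar> + \<bar>pullback D \<beta>2 z\<bar>"
      using AE_measure_preserving[OF product_coupling(1)[OF P P] eq]
        AE_measure_preserving[OF product_coupling(2)[OF P P] eq]
      by eventually_elim (auto simp: B_def D_def pullback_def split_beta' \<alpha>2_def \<beta>2_def)
  qed (use Dp[OF \<alpha>(2)] Dp[OF \<beta>(1)] in auto)
  also have "\<dots> \<le> e / 2"
    using Dp[OF \<alpha>(2)] Dp[OF \<beta>(1)] by (subst Bochner_Integration.integral_add) auto
  finally have B: "cut_norm P B \<le> e / 2" .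
  have "cut_distance M1 W1 M3 W3 \<le> cut_norm P (\<lambda>z. pullback W1 \<alpha>1 z - pullback W3 \<beta>3 z)"
    by (rule cut_distance_le[OF P W1 W3 \<alpha>(1) \<beta>(2)])
  \<comment> \<open>\<open>C\<close> is split off first and the rest is then split into
    \<open>A\<close> and \<open>B\<close>, so that each time the two summands are differences of two
    kernels and hence bounded by 1.\<close>
  also have "\<dots> = cut_norm P (\<lambda>z. (pullback W1 \<alpha>1 z - pullback W2 \<beta>2 z) + C z)"
    by (simp add: C_def)
  also have "\<dots> \<le> cut_norm P (\<lambda>z. pullback W1 \<alpha>1 z - pullback W2 \<beta>2 z) + cut_norm P C"
    unfolding C_def by (intro P.cut_norm_add_le pullback_diff[OF P W1 W2 \<alpha>(1) \<beta>(1)] pullback_diff[OF P W2 W3 \<beta>])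
  also have "(\<lambda>z. pullback W1 \<alpha>1 z - pullback W2 \<beta>2 z) = (\<lambda>z. A z + B z)"
    by (simp add: A_def B_def)
  also have "cut_norm P (\<lambda>z. A z + B z) \<le> cut_norm P A + cut_norm P B"
    unfolding A_def B_def
    by (intro P.cut_norm_add_le pullback_diff[OF P W1 W2 \<alpha>] pullback_diff[OF P W2 W2 \<alpha>(2) \<beta>(1)])
  finally show "cut_distance M1 W1 M3 W3 \<le> cut_distance M1 W1 M2 W2 + cut_distance M2 W2 M3 W3 + e"
    using A B C ltN ltK by simp
qed

subsection \<open>Cut distance and L1 distance of monotone kernels\<close>

lemma space_unit_leb: "space unit_leb = {0..1}"
  by simp

lemma sets_unit_leb: "A \<in> sets unit_leb \<longleftrightarrow> A \<in> sets lebesgue \<and> A \<subseteq> {0..1}"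
  by (subst sets_restrict_space_iff) auto

lemma emeasure_unit_leb: "A \<subseteq> {0..1} \<Longrightarrow> emeasure unit_leb A = emeasure lebesgue A"
  by (rule emeasure_restrict_space) auto

lemma prob_space_unit_leb: "prob_space unit_leb"
  by (rule prob_spaceI) (simp add: emeasure_unit_leb)

interpretation unit: prob_space unit_leb by (rule prob_space_unit_leb)
interpretation square: pair_prob_space unit_leb unit_leb ..

lemma measurable_unit_leb: "f \<in> borel_measurable borel \<Longrightarrow> f \<in> borel_measurable unit_leb"
  by (intro measurable_restrict_space1 measurable_completion) simp

lemma monotone_kernelsD:
  assumes "W \<in> monotone_kernels"
  shows "W \<in> kernels unit_leb"
    and "0 \<le> x1 \<Longrightarrow> x1 \<le> x2 \<Longrightarrow> x2 \<le> 1 \<Longrightarrow> 0 \<le> y1 \<Longrightarrow> y1 \<le> y2 \<Longrightarrow> y2 \<le> 1 \<Longrightarrow>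
      W (x1, y1) \<le> W (x2, y2)"
  using assms by (auto simp: monotone_kernels_def)

section \<open>Quadrant masses under couplings\<close>

text \<open>The bathtub principle. Both indicators have the same integral because both maps preserve
  measure, so subtracting from \<open>c\<close> its value at the threshold does not affect the
  comparison; after that the inequality holds pointwise. Measurability is asked of \<open>c\<close>
  composed with \<open>\<phi>2\<close>, the form in which a slice of a pulled-back kernel supplies
  it.\<close>

lemma upper_ray_maximises:
  fixes c :: "real \<Rightarrow> real"
  assumes N: "prob_space N"
    and \<phi>: "\<phi>1 \<in> measure_preserving N unit_leb" "\<phi>2 \<in> measure_preserving N unit_leb"
    and cm: "(\<lambda>s. c (\<phi>2 s)) \<in> borel_measurable N"
    and c1: "\<And>x. 0 \<le> x \<Longrightarrow> x \<le> 1 \<Longrightarrow> \<bar>c x\<bar> \<le> 1"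
    and mono: "\<And>x y. 0 \<le> x \<Longrightarrow> x \<le> y \<Longrightarrow> y \<le> 1 \<Longrightarrow> c x \<le> c y"
  shows "(\<integral>s. c (\<phi>2 s) * indicator {a..} (\<phi>1 s) \<partial>N) \<le> (\<integral>s. c (\<phi>2 s) * indicator {a..} (\<phi>2 s) \<partial>N)"
proof -
  interpret N: prob_space N by fact
  note [measurable] = measure_preservingD(1)[OF \<phi>(1)] measure_preservingD(1)[OF \<phi>(2)] cm
  have sp: "0 \<le> \<phi>1 s" "\<phi>1 s \<le> 1" "0 \<le> \<phi>2 s" "\<phi>2 s \<le> 1" if "s \<in> space N" for s
    using measurable_space[OF measure_preservingD(1)[OF \<phi>(1)] that]
      measurable_space[OF measure_preservingD(1)[OF \<phi>(2)] that] by auto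
  let ?i = "indicator {a..} :: real \<Rightarrow> real"
  have im: "?i \<in> borel_measurable unit_leb" by (rule measurable_unit_leb) auto
  note [measurable] = measurable_compose[OF measure_preservingD(1)[OF \<phi>(1)] im]
    measurable_compose[OF measure_preservingD(1)[OF \<phi>(2)] im]
  have int: "integrable N (\<lambda>s. ?i (\<phi>1 s))" "integrable N (\<lambda>s. ?i (\<phi>2 s))"
    by (auto intro!: N.integrable_const_bound[where B=1] AE_I2 split: split_indicator)
  have int': "integrable N (\<lambda>s. c (\<phi>2 s) * ?i (\<phi>1 s))" "integrable N (\<lambda>s. c (\<phi>2 s) * ?i (\<phi>2 s))"
    using sp c1 by (auto intro!: N.integrable_const_bound[where B=1] AE_I2 split: split_indicator)
  \<comment> \<open>The threshold is clamped to \<open>[0,1]\<close>, where \<open>c\<close> is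
    known to be monotone; for \<open>a\<close> outside the interval one of the two cases below
    covers every point.\<close>
  define a' where "a' = max 0 (min 1 a)"
  have "0 = c a' * ((\<integral>s. ?i (\<phi>2 s) \<partial>N) - (\<integral>s. ?i (\<phi>1 s) \<partial>N))"
    by (simp add: integral_measure_preserving[OF \<phi>(1) im] integral_measure_preserving[OF \<phi>(2) im])
  also have "\<dots> = (\<integral>s. c a' * (?i (\<phi>2 s) - ?i (\<phi>1 s)) \<partial>N)"
    using int by simp
  also have "\<dots> \<le> (\<integral>s. c (\<phi>2 s) * ?i (\<phi>2 s) - c (\<phi>2 s) * ?i (\<phi>1 s) \<partial>N)"
  proof (intro integral_mono)
    fix s assume "s \<in> space N"
    note s = sp[OF this]
    show "c a' * (?i (\<phi>2 s) - ?i (\<phi>1 s)) \<le> c (\<phi>2 s) * ?i (\<phi>2 s) - c (\<phi>2 s) * ?i (\<phi>1 s)"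
    proof (cases "a \<le> \<phi>2 s")
      case True
      then have "c a' \<le> c (\<phi>2 s)" using s by (intro mono) (auto simp: a'_def)
      then show ?thesis using True by (auto simp: indicator_def)
    next
      case False
      then have "c (\<phi>2 s) \<le> c a'" using s by (intro mono) (auto simp: a'_def)
      then show ?thesis using False by (auto simp: indicator_def)
    qed
  qed (use int int' in auto)
  also have "\<dots> = (\<integral>s. c (\<phi>2 s) * ?i (\<phi>2 s) \<partial>N) - (\<integral>s. c (\<phi>2 s) * ?i (\<phi>1 s) \<partial>N)"
    using int' by simp
  finally show ?thesis by simp
qed

definition quadrant_mass :: "(real \<times> real \<Rightarrow> real) \<Rightarrow> real \<Rightarrow> real \<Rightarrow> real" where
  "quadrant_mass W a b =
     (\<integral>(u, v). W (u, v) * indicator {a..} u * indicator {b..} v \<partial>(unit_leb \<Otimes>\<^sub>M unit_leb))"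

text \<open>The cut norm lets \<open>W1\<close> be exchanged for \<open>W2\<close> while the
  quadrant stays determined by \<open>\<phi>1\<close>. The bathtub principle, applied in each
  variable separately, then moves the quadrant to \<open>\<phi>2\<close>, which can only increase
  the integral of \<open>W2\<close>.\<close>

lemma quadrant_mass_le_coupling:
  assumes N: "prob_space N"
    and \<phi>: "\<phi>1 \<in> measure_preserving N unit_leb" "\<phi>2 \<in> measure_preserving N unit_leb"
    and W: "W1 \<in> monotone_kernels" "W2 \<in> monotone_kernels"
  shows "quadrant_mass W1 a b \<le> quadrant_mass W2 a b +
    cut_norm N (\<lambda>z. pullback W1 \<phi>1 z - pullback W2 \<phi>2 z)"
proof -
  interpret N: prob_space N by fact
  interpret NN: pair_prob_space N N ..
  note K = W[THEN monotone_kernelsD(1)]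
  note Wm[measurable] = kernelsD(1)[OF K(1)] kernelsD(1)[OF K(2)]
  note \<phi>m[measurable] = measure_preservingD(1)[OF \<phi>(1)] measure_preservingD(1)[OF \<phi>(2)]
  note sp = measurable_space[OF \<phi>m(1)] measurable_space[OF \<phi>m(2)]
  note pm[measurable] = pullback_measurable[OF Wm(1) \<phi>m(1)] pullback_measurable[OF Wm(2) \<phi>m(2)]
  have W01: "\<bar>pullback W1 \<phi>1 (s, t)\<bar> \<le> 1" "\<bar>pullback W2 \<phi>2 (s, t)\<bar> \<le> 1"
    if "s \<in> space N" "t \<in> space N" for s t
    using sp[OF that(1)] sp[OF that(2)] K[THEN kernelsD(3)] K[THEN kernelsD(4)]
    by (auto simp: pullback_def)
  have im: "(indicator {a..} :: real \<Rightarrow> real) \<in> borel_measurable unit_leb" for a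
    by (rule measurable_unit_leb) auto
  \<comment> \<open>The Boolean selects the map that determines the ray: \<open>True\<close> for
    \<open>\<phi>1\<close> and \<open>False\<close> for \<open>\<phi>2\<close>. The exchange then
    goes from \<open>(True, True)\<close> through \<open>(False, True)\<close> to
    \<open>(False, False)\<close>.\<close>
  define f where "f i s = (indicator {a..} ((if i then \<phi>1 else \<phi>2) s) :: real)" for i s
  define g where "g i s = (indicator {b..} ((if i then \<phi>1 else \<phi>2) s) :: real)" for i s
  have fm[measurable]: "f i \<in> borel_measurable N" and gm[measurable]: "g i \<in> borel_measurable N" for i
    unfolding f_def g_def using measurable_compose[OF \<phi>m(1) im] measurable_compose[OF \<phi>m(2) im] by auto
  have f01: "0 \<le> f i s" "f i s \<le> 1" and g01: "0 \<le> g i s" "g i s \<le> 1" for i s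
    by (auto simp: f_def g_def)
  let ?I = "\<lambda>V f g. (\<integral>(s, t). V (s, t) * f s * g t \<partial>(N \<Otimes>\<^sub>M N))"
  have qm: "(\<lambda>z. W z * indicator {a..} (fst z) * indicator {b..} (snd z))
      \<in> borel_measurable (unit_leb \<Otimes>\<^sub>M unit_leb)"
    if "W \<in> borel_measurable (unit_leb \<Otimes>\<^sub>M unit_leb)" for W :: "real \<times> real \<Rightarrow> real"
    using that by (intro borel_measurable_times measurable_compose[OF measurable_fst im]
        measurable_compose[OF measurable_snd im])
  have quad: "quadrant_mass W1 a b = ?I (pullback W1 \<phi>1) (f True) (g True)"
    "quadrant_mass W2 a b = ?I (pullback W2 \<phi>2) (f False) (g False)"
    unfolding quadrant_mass_def
    using integral_measure_preserving[OF measure_preserving_pair[OF N \<phi>(1)] qm[OF Wm(1)]]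
      integral_measure_preserving[OF measure_preserving_pair[OF N \<phi>(2)] qm[OF Wm(2)]]
    by (simp_all add: pullback_def f_def g_def split_beta')
  have int: "integrable (N \<Otimes>\<^sub>M N) (\<lambda>(s, t). pullback W1 \<phi>1 (s, t) * f i s * g j t)"
    "integrable (N \<Otimes>\<^sub>M N) (\<lambda>(s, t). pullback W2 \<phi>2 (s, t) * f i s * g j t)" for i j
    using W01 f01 g01 by (auto intro!: N.integrable_cut_test pm)
  have swap_slice: "(\<integral>s. pullback W2 \<phi>2 (s, t) * indicator {d..} (\<phi>1 s) \<partial>N) \<le>
      (\<integral>s. pullback W2 \<phi>2 (s, t) * indicator {d..} (\<phi>2 s) \<partial>N)" if t: "t \<in> space N" for t d
  proof -
    have "(\<lambda>s. pullback W2 \<phi>2 (s, t)) \<in> borel_measurable N" using t by measurable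
    then show ?thesis
      unfolding pullback_def prod.case using sp(2)[OF t] K(2)[THEN kernelsD(3)] K(2)[THEN kernelsD(4)]
      by (intro upper_ray_maximises[OF N \<phi>, where c="\<lambda>x. W2 (x, \<phi>2 t)"])
        (auto intro: monotone_kernelsD(2)[OF W(2)])
  qed
  have step1: "?I (pullback W2 \<phi>2) (f True) (g True) \<le> ?I (pullback W2 \<phi>2) (f False) (g True)"
  proof -
    have inner: "(\<integral>s. pullback W2 \<phi>2 (s, t) * f i s * g True t \<partial>N) =
        g True t * (\<integral>s. pullback W2 \<phi>2 (s, t) * f i s \<partial>N)" for t i
      by (simp add: mult.commute)
    have "?I (pullback W2 \<phi>2) (f i) (g True) =
      (\<integral>t. g True t * (\<integral>s. pullback W2 \<phi>2 (s, t) * f i s \<partial>N) \<partial>N)" for i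
      using NN.integral_snd[OF int(2)[of i True]] unfolding inner by simp
    moreover have "integrable N (\<lambda>t. g True t * (\<integral>s. pullback W2 \<phi>2 (s, t) * f i s \<partial>N))" for i
      using NN.integrable_snd[OF int(2)[of i True]] unfolding inner by simp
    moreover have "(\<integral>s. pullback W2 \<phi>2 (s, t) * f True s \<partial>N) \<le> (\<integral>s. pullback W2 \<phi>2 (s, t) * f False s \<partial>N)"
      if "t \<in> space N" for t
      using swap_slice[OF that, of a] by (simp add: f_def)
    ultimately show ?thesis
      using g01 by (simp only:) (rule integral_mono; simp add: mult_left_mono)
  qed
  have step2: "?I (pullback W2 \<phi>2) (f False) (g True) \<le> ?I (pullback W2 \<phi>2) (f False) (g False)"
  proof -
    \<comment> \<open>Symmetry of \<open>W2\<close> moves the integration variable into the first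
      argument, where \<open>swap_slice\<close> applies again.\<close>
    have inner: "(\<integral>t. pullback W2 \<phi>2 (s, t) * f False s * g j t \<partial>N) =
        f False s * (\<integral>t. pullback W2 \<phi>2 (t, s) * g j t \<partial>N)" if "s \<in> space N" for s j
    proof -
      have "(\<integral>t. pullback W2 \<phi>2 (s, t) * f False s * g j t \<partial>N) =
          (\<integral>t. f False s * (pullback W2 \<phi>2 (t, s) * g j t) \<partial>N)"
        using kernelsD(2)[OF K(2) sp(2)[OF that] sp(2)]
        by (intro Bochner_Integration.integral_cong) (auto simp: pullback_def)
      then show ?thesis by simp
    qed
    have "?I (pullback W2 \<phi>2) (f False) (g j) =
      (\<integral>s. f False s * (\<integral>t. pullback W2 \<phi>2 (t, s) * g j t \<partial>N) \<partial>N)" for j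
      using NN.integral_fst[OF int(2)[of False j]] inner by (simp cong: Bochner_Integration.integral_cong)
    moreover have "integrable N (\<lambda>s. f False s * (\<integral>t. pullback W2 \<phi>2 (t, s) * g j t \<partial>N))" for j
      using NN.integrable_fst[OF int(2)[of False j]] inner by (simp cong: Bochner_Integration.integrable_cong)
    moreover have "(\<integral>s. pullback W2 \<phi>2 (s, t) * g True s \<partial>N) \<le> (\<integral>s. pullback W2 \<phi>2 (s, t) * g False s \<partial>N)"
      if "t \<in> space N" for t
      using swap_slice[OF that, of b] by (simp add: g_def)
    ultimately show ?thesis
      using f01 by (simp only:) (rule integral_mono; simp add: mult_left_mono)
  qed
  \<comment> \<open>The indicators determined by \<open>\<phi>1\<close> are admissible test
    functions, so the cut norm bounds the difference of the two integrals over that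
    quadrant.\<close>
  have "?I (\<lambda>z. pullback W1 \<phi>1 z - pullback W2 \<phi>2 z) (f True) (g True) =
      (\<integral>z. (\<lambda>(s, t). pullback W1 \<phi>1 (s, t) * f True s * g True t) z -
        (\<lambda>(s, t). pullback W2 \<phi>2 (s, t) * f True s * g True t) z \<partial>(N \<Otimes>\<^sub>M N))"
    by (intro Bochner_Integration.integral_cong) (auto simp: algebra_simps)
  also have "\<dots> = ?I (pullback W1 \<phi>1) (f True) (g True) - ?I (pullback W2 \<phi>2) (f True) (g True)"
    by (intro Bochner_Integration.integral_diff int)
  finally have "?I (pullback W1 \<phi>1) (f True) (g True) - ?I (pullback W2 \<phi>2) (f True) (g True)
      \<le> \<bar>?I (\<lambda>z. pullback W1 \<phi>1 z - pullback W2 \<phi>2 z) (f True) (g True)\<bar>" by simp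
  also have "\<dots> \<le> cut_norm N (\<lambda>z. pullback W1 \<phi>1 z - pullback W2 \<phi>2 z)"
    using f01 g01 by (intro cut_norm_upper[OF N pullback_diff[OF N K \<phi>] fm _ gm]) (auto intro: order_trans[of _ 0])
  finally show ?thesis using step1 step2 quad by linarith
qed

lemma quadrant_mass_le_cut_distance:
  assumes W: "W1 \<in> monotone_kernels" "W2 \<in> monotone_kernels"
  shows "quadrant_mass W1 a b \<le> quadrant_mass W2 a b + cut_distance unit_leb W1 unit_leb W2"
proof (rule field_le_epsilon)
  fix e :: real assume "e > 0"
  then obtain N :: "(real \<times> real) measure" and \<phi>1 \<phi>2 where N: "prob_space N"
    and \<phi>: "\<phi>1 \<in> measure_preserving N unit_leb" "\<phi>2 \<in> measure_preserving N unit_leb"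
    and "cut_norm N (\<lambda>z. pullback W1 \<phi>1 z - pullback W2 \<phi>2 z) < cut_distance unit_leb W1 unit_leb W2 + e"
    using coupling_below[OF prob_space_unit_leb prob_space_unit_leb,
        of W1 W2 "cut_distance unit_leb W1 unit_leb W2 + e"] by auto
  with quadrant_mass_le_coupling[OF N \<phi> W, of a b]
  show "quadrant_mass W1 a b \<le> quadrant_mass W2 a b + cut_distance unit_leb W1 unit_leb W2 + e"
    by simp
qed

section \<open>Integrals over small squares\<close>

lemma integrable_kernel:
  assumes "W \<in> kernels unit_leb"
  shows "integrable (unit_leb \<Otimes>\<^sub>M unit_leb) W"
  using kernelsD[OF assms]
  by (intro square.integrable_const_bound[where B=1] AE_I2) (auto simp: space_pair_measure)

text \<open>A half-open interval is exactly the difference of two closed upper rays, so the product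
  expands into four quadrants with no boundary terms.\<close>

lemma quadrant_mass_square:
  assumes W: "W \<in> kernels unit_leb" and "0 < h"
  shows "(\<integral>(u, v). W (u, v) * indicator {x..<x+h} u * indicator {y..<y+h} v \<partial>(unit_leb \<Otimes>\<^sub>M unit_leb)) =
    quadrant_mass W x y - quadrant_mass W (x + h) y - quadrant_mass W x (y + h) + quadrant_mass W (x + h) (y + h)"
proof -
  define q where "q a b z = W z * indicator {a..} (fst z) * (indicator {b..} (snd z) :: real)" for a b z
  have q: "integrable (unit_leb \<Otimes>\<^sub>M unit_leb) (q a b)" for a b
  proof -
    have "integrable (unit_leb \<Otimes>\<^sub>M unit_leb) (\<lambda>(u, v). W (u, v) * indicator {a..} u * indicator {b..} v)"
      by (rule unit.integrable_cut_test)
        (use kernelsD[OF W] in \<open>auto intro: measurable_unit_leb split: split_indicator\<close>)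
    then show ?thesis by (simp add: q_def[abs_def] split_beta')
  qed
  have split: "indicator {a..<a+h} u = indicator {a..} u - (indicator {a + h..} u :: real)" for a u :: real
    using \<open>0 < h\<close> by (auto simp: indicator_def)
  have "(\<integral>(u, v). W (u, v) * indicator {x..<x+h} u * indicator {y..<y+h} v \<partial>(unit_leb \<Otimes>\<^sub>M unit_leb)) =
      (\<integral>z. q x y z - q (x + h) y z - q x (y + h) z + q (x + h) (y + h) z \<partial>(unit_leb \<Otimes>\<^sub>M unit_leb))"
    unfolding split by (intro Bochner_Integration.integral_cong) (auto simp: q_def algebra_simps)
  also have "\<dots> = (\<integral>z. q x y z \<partial>(unit_leb \<Otimes>\<^sub>M unit_leb)) - (\<integral>z. q (x + h) y z \<partial>(unit_leb \<Otimes>\<^sub>M unit_leb)) -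
      (\<integral>z. q x (y + h) z \<partial>(unit_leb \<Otimes>\<^sub>M unit_leb)) + (\<integral>z. q (x + h) (y + h) z \<partial>(unit_leb \<Otimes>\<^sub>M unit_leb))"
    using q by simp
  also have "\<dots> = quadrant_mass W x y - quadrant_mass W (x + h) y - quadrant_mass W x (y + h) +
      quadrant_mass W (x + h) (y + h)"
    by (simp add: quadrant_mass_def q_def split_beta')
  finally show ?thesis .
qed

lemma integral_indicator_square:
  fixes c h x y :: real
  assumes "0 < h" "0 \<le> x" "x + h \<le> 1" "0 \<le> y" "y + h \<le> 1"
  shows "(\<integral>(u, v). c * indicator {x..<x+h} u * indicator {y..<y+h} v \<partial>(unit_leb \<Otimes>\<^sub>M unit_leb)) = c * h\<^sup>2"
proof -
  have I: "(\<integral>u. indicator {a..<a+h} u \<partial>unit_leb) = h" if "0 \<le> a" "a + h \<le> 1" for a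
  proof -
    have sub: "{a..<a+h} \<subseteq> {0..1}" using that by auto
    then have "{a..<a+h} \<inter> space unit_leb = {a..<a+h}" by auto
    then show ?thesis
      using \<open>0 < h\<close> by (simp only: Bochner_Integration.integral_indicator) (simp add: measure_def emeasure_unit_leb[OF sub])
  qed
  have i: "integrable (unit_leb \<Otimes>\<^sub>M unit_leb) (\<lambda>(u, v). (1::real) * indicator {x..<x+h} u * indicator {y..<y+h} v)"
    by (rule unit.integrable_cut_test[of "\<lambda>_. 1"]) (auto intro: measurable_unit_leb split: split_indicator)
  have "(\<integral>(u, v). c * indicator {x..<x+h} u * indicator {y..<y+h} v \<partial>(unit_leb \<Otimes>\<^sub>M unit_leb)) =
      c * (\<integral>(u, v). (1::real) * indicator {x..<x+h} u * indicator {y..<y+h} v \<partial>(unit_leb \<Otimes>\<^sub>M unit_leb))"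
    by (subst integral_mult_right_zero[symmetric]) (simp add: split_beta' mult.assoc)
  also have "(\<integral>(u, v). (1::real) * indicator {x..<x+h} u * indicator {y..<y+h} v \<partial>(unit_leb \<Otimes>\<^sub>M unit_leb)) =
      (\<integral>u. (\<integral>v. (1::real) * indicator {x..<x+h} u * indicator {y..<y+h} v \<partial>unit_leb) \<partial>unit_leb)"
    by (rule square.integral_fst[symmetric, OF i])
  also have "\<dots> = h * h"
    unfolding mult_1 integral_mult_right_zero integral_mult_left_zero using assms by (simp only: I)
  finally show ?thesis by (simp add: power2_eq_square)
qed

text \<open>On the square with lower corner \<open>(x, y)\<close> and side \<open>h\<close>,
  \<open>W1\<close> is at least its value at the lower corner and \<open>W2\<close> at most its
  value at the upper corner. The two integrals over the square differ by at most four cut distances,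
  one for each quadrant, and dividing by the area gives the claim.\<close>

lemma monotone_kernel_shift_le:
  assumes W: "W1 \<in> monotone_kernels" "W2 \<in> monotone_kernels"
    and h: "0 < h" and x: "0 \<le> x" "x + h \<le> 1" and y: "0 \<le> y" "y + h \<le> 1"
  shows "W1 (x, y) \<le> W2 (x + h, y + h) + 4 * cut_distance unit_leb W1 unit_leb W2 / h\<^sup>2"
proof -
  note K = W[THEN monotone_kernelsD(1)]
  note comm = cut_distance_commute[OF prob_space_unit_leb prob_space_unit_leb K]
  let ?Q = "\<lambda>F. (\<integral>(u, v). F (u, v) * indicator {x..<x+h} u * indicator {y..<y+h} v \<partial>(unit_leb \<Otimes>\<^sub>M unit_leb))"
  have int: "integrable (unit_leb \<Otimes>\<^sub>M unit_leb)
      (\<lambda>(u, v). F (u, v) * indicator {x..<x+h} u * indicator {y..<y+h} v)"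
    if "F \<in> kernels unit_leb" for F
    by (rule unit.integrable_cut_test)
      (use kernelsD[OF that] in \<open>auto intro: measurable_unit_leb split: split_indicator\<close>)
  \<comment> \<open>Constants count as kernels, so \<open>int\<close> also covers the bounds by
    corner values.\<close>
  have const: "(\<lambda>_. F z) \<in> kernels unit_leb" if "F \<in> kernels unit_leb" "z \<in> {0..1} \<times> {0..1}" for F z
    using kernelsD(3,4)[OF that(1), of "fst z" "snd z"] that(2) by (auto simp: kernels_def)
  have "W1 (x, y) * h\<^sup>2 = ?Q (\<lambda>_. W1 (x, y))"
    by (rule integral_indicator_square[symmetric]) fact+
  also have "\<dots> \<le> ?Q W1"
    using x y h by (intro integral_mono int const[OF K(1)] K(1))
      (auto simp: indicator_def space_pair_measure intro: monotone_kernelsD(2)[OF W(1)])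
  \<comment> \<open>The quadrants with positive sign use the comparison of \<open>W1\<close> with
    \<open>W2\<close>, those with negative sign the reverse one; symmetry of the cut distance puts
    the same error on all four.\<close>
  also have "\<dots> \<le> ?Q W2 + 4 * cut_distance unit_leb W1 unit_leb W2"
    unfolding quadrant_mass_square[OF K(1) h] quadrant_mass_square[OF K(2) h]
    using quadrant_mass_le_cut_distance[OF W, of x y]
      quadrant_mass_le_cut_distance[OF W(2,1), of "x + h" y]
      quadrant_mass_le_cut_distance[OF W(2,1), of x "y + h"]
      quadrant_mass_le_cut_distance[OF W, of "x + h" "y + h"] comm
    by linarith
  finally have "W1 (x, y) * h\<^sup>2 \<le> ?Q W2 + 4 * cut_distance unit_leb W1 unit_leb W2" .
  moreover have "?Q W2 \<le> ?Q (\<lambda>_. W2 (x + h, y + h))"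
    using x y h by (intro integral_mono int const[OF K(2)] K(2))
      (auto simp: indicator_def space_pair_measure intro!: monotone_kernelsD(2)[OF W(2)])
  moreover have "?Q (\<lambda>_. W2 (x + h, y + h)) = W2 (x + h, y + h) * h\<^sup>2"
    by (rule integral_indicator_square) fact+
  ultimately have "W1 (x, y) * h\<^sup>2 \<le> W2 (x + h, y + h) * h\<^sup>2 + 4 * cut_distance unit_leb W1 unit_leb W2"
    by linarith
  then show ?thesis using h by (simp add: field_simps)
qed

section \<open>The rotation and the L1 bound\<close>

text \<open>Translation by \<open>h\<close> modulo 1, a measure-preserving substitute for the shift
  of the arguments. For \<open>0 < h < 1\<close> fixing the point 1 makes it a bijection of
  \<open>[0,1]\<close>.\<close>

definition unit_rotation :: "real \<Rightarrow> real \<Rightarrow> real" where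
  "unit_rotation h x = (if x < 1 - h then x + h else if x < 1 then x + h - 1 else 1)"

lemma unit_rotation_measure_preserving:
  assumes h: "0 < h" "h < 1"
  shows "unit_rotation h \<in> measure_preserving unit_leb unit_leb"
proof -
  \<comment> \<open>The preimage consists of two translated pieces and the fixed point. They lie in
    \<open>[0, 1-h)\<close>, \<open>[1-h, 1)\<close> and \<open>{1}\<close>, so they are disjoint
    and translation invariance gives the measure of each.\<close>
  have pre: "unit_rotation h -` A \<inter> {0..1} =
      (+) (- h) ` (A \<inter> {h..<1}) \<union> ((+) (1 - h) ` (A \<inter> {0..<h}) \<union> (A \<inter> {1}))" (is "?L = ?R")
    if "A \<subseteq> {0..1}" for A
  proof
    show "?L \<subseteq> ?R"
    proof
      fix x assume x: "x \<in> ?L"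
      consider "x < 1 - h" | "1 - h \<le> x" "x < 1" | "x = 1" using x by fastforce
      then show "x \<in> ?R"
      proof cases
        case 1
        then have "x = - h + (x + h)" "x + h \<in> A \<inter> {h..<1}" using x h by (auto simp: unit_rotation_def)
        then show ?thesis by blast
      next
        case 2
        then have "x = (1 - h) + (x + h - 1)" "x + h - 1 \<in> A \<inter> {0..<h}"
          using x h by (auto simp: unit_rotation_def)
        then show ?thesis by blast
      qed (use x h in \<open>auto simp: unit_rotation_def\<close>)
    qed
    show "?R \<subseteq> ?L" using h that by (auto simp: unit_rotation_def)
  qed
  have meas: "(+) (- h) ` (A \<inter> {h..<1}) \<in> sets lebesgue" "(+) (1 - h) ` (A \<inter> {0..<h}) \<in> sets lebesgue"
    if "A \<in> sets lebesgue" for A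
    by (rule lebesgue_sets_translation, use that in auto)+
  have transl: "emeasure lebesgue ((+) c ` S) = emeasure lebesgue S" for c :: real and S
    using emeasure_lebesgue_affine[of 1 c S] by (simp add: add.commute)
  have m: "unit_rotation h \<in> unit_leb \<rightarrow>\<^sub>M unit_leb"
  proof (rule measurableI)
    fix A assume "A \<in> sets unit_leb"
    then have A: "A \<in> sets lebesgue" "A \<subseteq> {0..1}" by (auto simp: sets_unit_leb)
    have "unit_rotation h -` A \<inter> {0..1} \<in> sets lebesgue"
      unfolding pre[OF A(2)] using A(1) by (intro sets.Un meas sets.Int) auto
    then show "unit_rotation h -` A \<inter> space unit_leb \<in> sets unit_leb"
      by (simp add: sets_unit_leb)
  qed (use h in \<open>auto simp: unit_rotation_def\<close>)
  have "distr unit_leb unit_leb (unit_rotation h) = unit_leb"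
  proof (rule measure_eqI)
    fix A assume "A \<in> sets (distr unit_leb unit_leb (unit_rotation h))"
    then have A': "A \<in> sets unit_leb" by simp
    then have A: "A \<in> sets lebesgue" "A \<subseteq> {0..1}" by (auto simp: sets_unit_leb)
    have A0: "A \<inter> {0..<h} \<in> sets lebesgue" using A(1) by (intro sets.Int) auto
    have A1: "A \<inter> {1} \<in> sets lebesgue" using A(1) by (intro sets.Int) auto
    have "emeasure (distr unit_leb unit_leb (unit_rotation h)) A =
        emeasure unit_leb (unit_rotation h -` A \<inter> space unit_leb)"
      by (rule emeasure_distr[OF m A'])
    also have "\<dots> = emeasure lebesgue (unit_rotation h -` A \<inter> {0..1})"
      unfolding space_unit_leb by (rule emeasure_unit_leb) auto
    also have "\<dots> = emeasure lebesgue ((+) (- h) ` (A \<inter> {h..<1})) +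
        emeasure lebesgue ((+) (1 - h) ` (A \<inter> {0..<h}) \<union> (A \<inter> {1}))"
      unfolding pre[OF A(2)]
      by (rule plus_emeasure[symmetric]) (use h meas[OF A(1)] A(1) A1 A0 in \<open>auto intro: sets.Un\<close>)
    also have "emeasure lebesgue ((+) (1 - h) ` (A \<inter> {0..<h}) \<union> (A \<inter> {1})) =
        emeasure lebesgue ((+) (1 - h) ` (A \<inter> {0..<h})) + emeasure lebesgue (A \<inter> {1})"
      by (rule plus_emeasure[symmetric]) (use h meas[OF A(1)] A(1) A1 A0 in \<open>auto intro: sets.Un\<close>)
    also have "emeasure lebesgue ((+) (- h) ` (A \<inter> {h..<1})) +
        (emeasure lebesgue ((+) (1 - h) ` (A \<inter> {0..<h})) + emeasure lebesgue (A \<inter> {1})) =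
        emeasure lebesgue (A \<inter> {h..<1}) + (emeasure lebesgue (A \<inter> {0..<h}) + emeasure lebesgue (A \<inter> {1}))"
      by (simp only: transl)
    also have "\<dots> = emeasure lebesgue (A \<inter> {h..<1}) + emeasure lebesgue ((A \<inter> {0..<h}) \<union> (A \<inter> {1}))"
      by (subst plus_emeasure) (use h A(1) A1 A0 in \<open>auto intro: sets.Un\<close>)
    also have "\<dots> = emeasure lebesgue ((A \<inter> {h..<1}) \<union> ((A \<inter> {0..<h}) \<union> (A \<inter> {1})))"
      by (rule plus_emeasure) (use h A(1) A1 A0 in \<open>auto intro: sets.Un\<close>)
    also have "(A \<inter> {h..<1}) \<union> ((A \<inter> {0..<h}) \<union> (A \<inter> {1})) = A"
      using A(2) h by fastforce
    finally show "emeasure (distr unit_leb unit_leb (unit_rotation h)) A = emeasure unit_leb A"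
      by (simp only: emeasure_unit_leb[OF A(2)])
  qed simp
  with m show ?thesis by (simp add: measure_preserving_def)
qed

text \<open>Where neither coordinate wraps around, \<open>W1 - W2\<close> is bounded by a constant plus the increment of
  \<open>W2\<close> under the rotation, and such increments integrate to 0.\<close>

lemma monotone_kernels_L1_le:
  assumes W: "W1 \<in> monotone_kernels" "W2 \<in> monotone_kernels" and h: "0 < h" "h < 1"
  shows "(\<integral>z. \<bar>W1 z - W2 z\<bar> \<partial>(unit_leb \<Otimes>\<^sub>M unit_leb))
    \<le> 4 * cut_distance unit_leb W1 unit_leb W2 / h\<^sup>2 + 6 * h"
proof -
  note K = W[THEN monotone_kernelsD(1)]
  let ?S = "unit_leb \<Otimes>\<^sub>M unit_leb"
  define \<delta> where "\<delta> = 4 * cut_distance unit_leb W1 unit_leb W2 / h\<^sup>2"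
  have \<delta>: "0 \<le> \<delta>"
    unfolding \<delta>_def using cut_distance_nonneg[OF prob_space_unit_leb prob_space_unit_leb K] by simp
  note R = unit_rotation_measure_preserving[OF h]
  define D where "D W z = pullback W (unit_rotation h) z - W z" for W z
  note Wi = integrable_kernel
  have Wi': "integrable ?S (pullback W (unit_rotation h))" if "W \<in> kernels unit_leb" for W
    using kernelsD[OF that] measurable_space[OF measure_preservingD(1)[OF R]]
    by (intro square.integrable_const_bound[where B=1] AE_I2 pullback_measurable[OF _ measure_preservingD(1)[OF R]])
      (auto simp: space_pair_measure pullback_def)
  have Di: "integrable ?S (D W)" if "W \<in> kernels unit_leb" for W
    unfolding D_def using Wi[OF that] Wi'[OF that] by simp
  have D0: "(\<integral>z. D W z \<partial>?S) = 0" if "W \<in> kernels unit_leb" for W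
    using integral_measure_preserving[OF measure_preserving_pair[OF prob_space_unit_leb R] kernelsD(1)[OF that]]
      Wi[OF that] Wi'[OF that] unfolding D_def by (simp add: pullback_def split_beta')
  \<comment> \<open>The strip where a coordinate wraps around or is the endpoint 1; its measure is
    \<open>h\<close>.\<close>
  let ?e = "\<lambda>x. indicator {1-h..1} x :: real"
  have em: "?e \<in> borel_measurable unit_leb" by (rule measurable_unit_leb) auto
  have eI: "(\<integral>x. ?e x \<partial>unit_leb) = h"
  proof -
    have sub: "{1-h..1} \<subseteq> {0..1}" using h by auto
    then have "{1-h..1} \<inter> space unit_leb = {1-h..1}" by auto
    then show ?thesis
      using h by (simp only: Bochner_Integration.integral_indicator) (simp add: measure_def emeasure_unit_leb[OF sub])
  qed
  note fs = product_coupling[OF prob_space_unit_leb prob_space_unit_leb]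
  have ei: "integrable ?S (\<lambda>z. ?e (fst z))" "integrable ?S (\<lambda>z. ?e (snd z))"
    using measurable_compose[OF measurable_fst em] measurable_compose[OF measurable_snd em]
    by (auto intro!: square.integrable_const_bound[where B=1] AE_I2 simp: indicator_def)
  have eS: "(\<integral>z. ?e (fst z) \<partial>?S) = h" "(\<integral>z. ?e (snd z) \<partial>?S) = h"
    using integral_measure_preserving[OF fs(1) em] integral_measure_preserving[OF fs(2) em] eI
    by (simp_all only:)
  \<comment> \<open>Away from the strips both increments are nonnegative, so adding both bounds
    \<open>W1 z - W2 z\<close> from either side. On the strips the factor 3 pays for three
    quantities of modulus at most 1: the difference itself and the two increments. This is the
    source of the term \<open>6 * h\<close>.\<close>
  have ptw: "\<bar>W1 z - W2 z\<bar> \<le> \<delta> + D W1 z + D W2 z + 3 * ?e (fst z) + 3 * ?e (snd z)"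
    if zS: "z \<in> space ?S" for z
  proof -
    obtain x y where z: "z = (x, y)" and xy: "0 \<le> x" "x \<le> 1" "0 \<le> y" "y \<le> 1"
      using zS by (cases z) (auto simp: space_pair_measure)
    show ?thesis
    proof (cases "x < 1 - h \<and> y < 1 - h")
      case True
      then have R: "unit_rotation h x = x + h" "unit_rotation h y = y + h"
        by (auto simp: unit_rotation_def)
      have "0 \<le> D W1 z" "0 \<le> D W2 z"
        unfolding D_def z pullback_def prod.case R using xy h True
        by (auto intro!: monotone_kernelsD(2)[OF W(1)] monotone_kernelsD(2)[OF W(2)])
      moreover have "W1 z - W2 z \<le> \<delta> + D W2 z"
        using monotone_kernel_shift_le[OF W h(1), of x y] xy h True
        by (simp add: D_def z pullback_def R \<delta>_def)
      moreover have "W2 z - W1 z \<le> \<delta> + D W1 z"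
        using monotone_kernel_shift_le[OF W(2,1) h(1), of x y] xy h True
        by (simp add: D_def z pullback_def R \<delta>_def
            cut_distance_commute[OF prob_space_unit_leb prob_space_unit_leb K])
      ultimately show ?thesis using True by (auto simp: z)
    next
      case False
      have r: "unit_rotation h x \<in> {0..1}" "unit_rotation h y \<in> {0..1}"
        using xy h by (auto simp: unit_rotation_def)
      have "\<bar>D W1 z\<bar> \<le> 1" "\<bar>D W2 z\<bar> \<le> 1" "\<bar>W1 z - W2 z\<bar> \<le> 1"
        using xy r K[THEN kernelsD(3), of x y] K[THEN kernelsD(4), of x y]
          K[THEN kernelsD(3), of "unit_rotation h x" "unit_rotation h y"]
          K[THEN kernelsD(4), of "unit_rotation h x" "unit_rotation h y"]
        by (auto simp: D_def z pullback_def)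
      moreover have "?e x + ?e y \<ge> 1" using False xy by (auto simp: indicator_def)
      ultimately show ?thesis using \<delta> by (simp add: z)
    qed
  qed
  have "(\<integral>z. \<bar>W1 z - W2 z\<bar> \<partial>?S) \<le> (\<integral>z. \<delta> + D W1 z + D W2 z + 3 * ?e (fst z) + 3 * ?e (snd z) \<partial>?S)"
    using ptw by (intro integral_mono) (auto simp: Wi K Di ei)
  also have "\<dots> = \<delta> + 6 * h"
    using ei Di[OF K(1)] Di[OF K(2)]
    by (simp add: D0 K eS square.prob_space)
  finally show ?thesis unfolding \<delta>_def .
qed

subsection \<open>The metric spaces\<close>

lemma equiv_L1_equiv: "equiv {f. integrable M f} (L1_equiv M)"
proof (rule equivI)
  show "trans (L1_equiv M)"
  proof (rule transI)
    fix f g k assume fg: "(f, g) \<in> L1_equiv M" and gk: "(g, k) \<in> L1_equiv M"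
    have "AE x in M. f x = g x" "AE x in M. g x = k x" using fg gk by (auto simp: L1_equiv_def)
    then have "AE x in M. f x = k x" by eventually_elim simp
    then show "(f, k) \<in> L1_equiv M" using fg gk by (auto simp: L1_equiv_def)
  qed
qed (auto simp: L1_equiv_def refl_on_def sym_def eq_commute)

lemma L1_space_eq: "L1_space M = L1_class M ` {f. integrable M f}"
  by (auto simp: L1_space_def L1_class_def quotient_def)

lemma L1_class_eq_iff:
  assumes "integrable M f" "integrable M g"
  shows "L1_class M f = L1_class M g \<longleftrightarrow> (\<integral>x. \<bar>f x - g x\<bar> \<partial>M) = 0"
proof -
  have "L1_class M f = L1_class M g \<longleftrightarrow> (AE x in M. f x = g x)"
    unfolding L1_class_def using assms
    by (subst eq_equiv_class_iff[OF equiv_L1_equiv]) (auto simp: L1_equiv_def)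
  also have "\<dots> \<longleftrightarrow> (\<integral>x. \<bar>f x - g x\<bar> \<partial>M) = 0"
    using assms by (subst integral_nonneg_eq_0_iff_AE) auto
  finally show ?thesis .
qed

text \<open>Two representatives of a class agree a.e., so the choice made by \<open>SOME\<close> in
  \<open>L1_dist\<close> is immaterial.\<close>

lemma L1_dist_class:
  assumes f: "integrable M f" and g: "integrable M g"
  shows "L1_dist M (L1_class M f) (L1_class M g) = (\<integral>x. \<bar>f x - g x\<bar> \<partial>M)"
proof -
  have rep: "(f, SOME f'. f' \<in> L1_class M f) \<in> L1_equiv M" if "integrable M f" for f
    using someI[of "\<lambda>f'. f' \<in> L1_class M f" f] that by (auto simp: L1_class_def L1_equiv_def)
  note r = rep[OF f] rep[OF g]
  have "AE x in M. f x = (SOME f'. f' \<in> L1_class M f) x" "AE x in M. g x = (SOME f'. f' \<in> L1_class M g) x"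
    using r by (simp_all add: L1_equiv_def)
  then have "AE x in M. \<bar>(SOME f'. f' \<in> L1_class M f) x - (SOME f'. f' \<in> L1_class M g) x\<bar> = \<bar>f x - g x\<bar>"
    by eventually_elim simp
  then show ?thesis
    unfolding L1_dist_def using r by (intro integral_cong_AE) (auto simp: L1_equiv_def)
qed

lemma Metric_space_L1: "Metric_space (L1_space M) (L1_dist M)"
proof
  fix A B C
  show "0 \<le> L1_dist M A B" by (simp add: L1_dist_def)
  show "L1_dist M A B = L1_dist M B A" by (simp add: L1_dist_def abs_minus_commute)
  show "L1_dist M A B = 0 \<longleftrightarrow> A = B" if "A \<in> L1_space M" "B \<in> L1_space M"
    using that unfolding L1_space_eq by (elim imageE) (simp add: L1_dist_class L1_class_eq_iff)
  assume "A \<in> L1_space M" "B \<in> L1_space M" "C \<in> L1_space M"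
  then obtain f g k where fgk: "integrable M f" "integrable M g" "integrable M k"
    and eq: "A = L1_class M f" "B = L1_class M g" "C = L1_class M k"
    by (auto simp: L1_space_eq)
  have "(\<integral>x. \<bar>f x - k x\<bar> \<partial>M) \<le> (\<integral>x. \<bar>f x - g x\<bar> + \<bar>g x - k x\<bar> \<partial>M)"
    using fgk by (intro integral_mono) auto
  also have "\<dots> = (\<integral>x. \<bar>f x - g x\<bar> \<partial>M) + (\<integral>x. \<bar>g x - k x\<bar> \<partial>M)"
    using fgk by simp
  finally show "L1_dist M A C \<le> L1_dist M A B + L1_dist M B C"
    using fgk by (simp add: eq L1_dist_class)
qed

section \<open>The metric on graph limits\<close>

lemma cut_distance_self:
  assumes "prob_space M" "W \<in> kernels M"
  shows "cut_distance M W M W = 0"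
  using cut_distance_le_L1[OF assms(1,2,2)] cut_distance_nonneg[OF assms(1,1,2,2)] by simp

lemmas unit_cut_distance_nonneg = cut_distance_nonneg[OF prob_space_unit_leb prob_space_unit_leb]
lemmas unit_cut_distance_commute = cut_distance_commute[OF prob_space_unit_leb prob_space_unit_leb]
lemmas unit_cut_distance_triangle = cut_distance_triangle[OF prob_space_unit_leb prob_space_unit_leb prob_space_unit_leb]

lemma equiv_kernel_equiv: "equiv (kernels unit_leb) kernel_equiv"
proof (rule equivI)
  show "kernel_equiv \<subseteq> kernels unit_leb \<times> kernels unit_leb" by (auto simp: kernel_equiv_def)
  show "refl_on (kernels unit_leb) kernel_equiv"
    by (auto simp: refl_on_def kernel_equiv_def cut_distance_self[OF prob_space_unit_leb])
  show "sym kernel_equiv" by (auto simp: sym_def kernel_equiv_def unit_cut_distance_commute)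
  show "trans kernel_equiv"
  proof (rule transI)
    fix U V W assume "(U, V) \<in> kernel_equiv" "(V, W) \<in> kernel_equiv"
    then show "(U, W) \<in> kernel_equiv"
      using unit_cut_distance_triangle[of U V W] unit_cut_distance_nonneg[of U W] by (auto simp: kernel_equiv_def)
  qed
qed

lemma graph_limits_eq: "graph_limits = graph_limit_of ` kernels unit_leb"
  by (auto simp: graph_limits_def graph_limit_of_def quotient_def)

lemma graph_limit_of_eq_iff:
  assumes "V \<in> kernels unit_leb" "W \<in> kernels unit_leb"
  shows "graph_limit_of V = graph_limit_of W \<longleftrightarrow> cut_distance unit_leb V unit_leb W = 0"
  unfolding graph_limit_of_def using assms
  by (subst eq_equiv_class_iff[OF equiv_kernel_equiv]) (auto simp: kernel_equiv_def)

lemma graph_limit_dist_of: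
  assumes V: "V \<in> kernels unit_leb" and W: "W \<in> kernels unit_leb"
  shows "graph_limit_dist (graph_limit_of V) (graph_limit_of W) = cut_distance unit_leb V unit_leb W"
proof -
  have rep: "(W, SOME W'. W' \<in> graph_limit_of W) \<in> kernel_equiv" if "W \<in> kernels unit_leb" for W
    using someI[of "\<lambda>W'. W' \<in> graph_limit_of W" W] that
    by (auto simp: graph_limit_of_def kernel_equiv_def cut_distance_self[OF prob_space_unit_leb])
  define V' where "V' = (SOME W'. W' \<in> graph_limit_of V)"
  define W' where "W' = (SOME W'. W' \<in> graph_limit_of W)"
  have V': "V' \<in> kernels unit_leb" "cut_distance unit_leb V unit_leb V' = 0"
    and W': "W' \<in> kernels unit_leb" "cut_distance unit_leb W unit_leb W' = 0"
    using rep[OF V] rep[OF W] by (auto simp: V'_def W'_def kernel_equiv_def)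
  \<comment> \<open>Two triangle inequalities for each direction: passing to an equivalent kernel
    costs 0, so the chosen representatives may be replaced by \<open>V\<close> and
    \<open>W\<close>.\<close>
  have "cut_distance unit_leb V' unit_leb W' = cut_distance unit_leb V unit_leb W"
    using unit_cut_distance_triangle[OF V V'(1) W] unit_cut_distance_triangle[OF V'(1) W'(1) W] unit_cut_distance_triangle[OF V'(1) V W'(1)]
      unit_cut_distance_triangle[OF V W W'(1)] V'(2) W'(2) unit_cut_distance_commute[OF V V'(1)] unit_cut_distance_commute[OF W W'(1)]
    by linarith
  then show ?thesis
    using V W by (simp add: graph_limit_dist_def graph_limits_eq V'_def W'_def)
qed

lemma Metric_space_graph_limits: "Metric_space graph_limits graph_limit_dist"
proof
  fix A B C
  have nonneg: "0 \<le> graph_limit_dist A B" if "A \<in> graph_limits" "B \<in> graph_limits"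
    using that by (auto simp: graph_limits_eq graph_limit_dist_of unit_cut_distance_nonneg)
  then show "0 \<le> graph_limit_dist A B"
    by (auto simp: graph_limit_dist_def)
  have "graph_limit_dist A B = graph_limit_dist B A" if "A \<in> graph_limits" "B \<in> graph_limits"
    using that by (auto simp: graph_limits_eq graph_limit_dist_of unit_cut_distance_commute)
  then show "graph_limit_dist A B = graph_limit_dist B A"
    by (auto simp: graph_limit_dist_def)
  show "graph_limit_dist A B = 0 \<longleftrightarrow> A = B" if "A \<in> graph_limits" "B \<in> graph_limits"
    using that unfolding graph_limits_eq by (elim imageE) (simp add: graph_limit_dist_of graph_limit_of_eq_iff)
  show "graph_limit_dist A C \<le> graph_limit_dist A B + graph_limit_dist B C"
    if "A \<in> graph_limits" "B \<in> graph_limits" "C \<in> graph_limits"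
    using that by (auto simp: graph_limits_eq graph_limit_dist_of unit_cut_distance_triangle)
qed

section \<open>Comparison of the two metrics on monotone kernels\<close>

text \<open>First \<open>h\<close> is fixed so that the boundary term \<open>6 * h\<close> is at
  most \<open>e / 2\<close>; then \<open>d\<close> makes the quotient by \<open>h\<^sup>2\<close>
  smaller than \<open>e / 2\<close>. The threshold depends on \<open>e\<close> alone.\<close>

lemma monotone_kernels_L1_small:
  assumes "0 < e"
  obtains d where "0 < d" "\<And>V W. V \<in> monotone_kernels \<Longrightarrow> W \<in> monotone_kernels \<Longrightarrow>
    cut_distance unit_leb V unit_leb W < d \<Longrightarrow> (\<integral>z. \<bar>V z - W z\<bar> \<partial>(unit_leb \<Otimes>\<^sub>M unit_leb)) < e"
proof -
  define h where "h = min (1 / 2) (e / 12)"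
  have h: "0 < h" "h < 1" "6 * h \<le> e / 2" using assms by (auto simp: h_def)
  show ?thesis
  proof (rule that[of "e * h\<^sup>2 / 8"])
    show "0 < e * h\<^sup>2 / 8" using assms h by simp
    fix V W assume "V \<in> monotone_kernels" "W \<in> monotone_kernels"
      and lt: "cut_distance unit_leb V unit_leb W < e * h\<^sup>2 / 8"
    from lt have "4 * cut_distance unit_leb V unit_leb W / h\<^sup>2 < e / 2"
      using h by (simp add: field_simps)
    with monotone_kernels_L1_le[OF \<open>V \<in> monotone_kernels\<close> \<open>W \<in> monotone_kernels\<close> h(1,2)] h(3)
    show "(\<integral>z. \<bar>V z - W z\<bar> \<partial>(unit_leb \<Otimes>\<^sub>M unit_leb)) < e" by linarith
  qed
qed

text \<open>One direction gives uniqueness of the monotone representative, the other makes the map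
  from L1 classes to graph limits well defined. A vanishing cut distance lies below every threshold
  \<open>d\<close>, so the L1 distance is below every \<open>e\<close>.\<close>

lemma graph_limit_of_eq_iff_L1_class_eq:
  assumes V: "V \<in> monotone_kernels" and W: "W \<in> monotone_kernels"
  shows "graph_limit_of V = graph_limit_of W \<longleftrightarrow>
    L1_class (unit_leb \<Otimes>\<^sub>M unit_leb) V = L1_class (unit_leb \<Otimes>\<^sub>M unit_leb) W"
proof -
  note K = monotone_kernelsD(1)[OF V] monotone_kernelsD(1)[OF W]
  let ?I = "\<integral>z. \<bar>V z - W z\<bar> \<partial>(unit_leb \<Otimes>\<^sub>M unit_leb)"
  have "?I \<le> 0" if "cut_distance unit_leb V unit_leb W = 0"
  proof (rule field_le_epsilon)
    fix e :: real assume "0 < e"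
    from monotone_kernels_L1_small[OF this] obtain d where "0 < d"
      and "\<And>V W. V \<in> monotone_kernels \<Longrightarrow> W \<in> monotone_kernels \<Longrightarrow>
        cut_distance unit_leb V unit_leb W < d \<Longrightarrow> (\<integral>z. \<bar>V z - W z\<bar> \<partial>(unit_leb \<Otimes>\<^sub>M unit_leb)) < e"
      by blast
    from this(2)[OF V W] \<open>0 < d\<close> that show "?I \<le> 0 + e" by simp
  qed
  moreover have "0 \<le> ?I" by simp
  ultimately have "cut_distance unit_leb V unit_leb W = 0 \<longleftrightarrow> ?I = 0"
    using cut_distance_le_L1[OF prob_space_unit_leb K] unit_cut_distance_nonneg[OF K] by linarith
  then show ?thesis
    by (simp add: graph_limit_of_eq_iff[OF K] L1_class_eq_iff[OF integrable_kernel[OF K(1)] integrable_kernel[OF K(2)]])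
qed

theorem corollary4p2:
  shows "(\<forall>G\<in>monotone_graph_limits. \<exists>W\<in>monotone_kernels. graph_limit_of W = G \<and>
            (\<forall>W'\<in>monotone_kernels. graph_limit_of W' = G \<longrightarrow>
               (AE z in unit_leb \<Otimes>\<^sub>M unit_leb. W' z = W z)))
       \<and> (\<exists>h. homeomorphic_map
              (subtopology (L1_topology (unit_leb \<Otimes>\<^sub>M unit_leb))
                 (L1_class (unit_leb \<Otimes>\<^sub>M unit_leb) ` monotone_kernels))
              (subtopology graph_limit_topology monotone_graph_limits) h \<and>
            (\<forall>W\<in>monotone_kernels. h (L1_class (unit_leb \<Otimes>\<^sub>M unit_leb) W) = graph_limit_of W))"
proof (intro conjI)
  let ?S = "unit_leb \<Otimes>\<^sub>M unit_leb"
  let ?L = "L1_class ?S"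
  note eq = graph_limit_of_eq_iff_L1_class_eq
  have Ki: "integrable ?S W" if "W \<in> monotone_kernels" for W
    by (rule integrable_kernel[OF monotone_kernelsD(1)[OF that]])
  show "\<forall>G\<in>monotone_graph_limits. \<exists>W\<in>monotone_kernels. graph_limit_of W = G \<and>
            (\<forall>W'\<in>monotone_kernels. graph_limit_of W' = G \<longrightarrow> (AE z in ?S. W' z = W z))"
  proof
    fix G assume "G \<in> monotone_graph_limits"
    then obtain W where W: "W \<in> monotone_kernels" "graph_limit_of W = G"
      by (auto simp: monotone_graph_limits_def)
    have "AE z in ?S. W' z = W z" if W': "W' \<in> monotone_kernels" "graph_limit_of W' = G" for W'
    proof -
      have "?L W' = ?L W" using W W' eq[OF W'(1) W(1)] by simp
      then have "(W', W) \<in> L1_equiv ?S"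
        unfolding L1_class_def by (rule eq_equiv_class[OF _ equiv_L1_equiv]) (use Ki W in auto)
      then show ?thesis by (simp add: L1_equiv_def)
    qed
    with W show "\<exists>W\<in>monotone_kernels. graph_limit_of W = G \<and>
            (\<forall>W'\<in>monotone_kernels. graph_limit_of W' = G \<longrightarrow> (AE z in ?S. W' z = W z))"
      by blast
  qed
  \<comment> \<open>Both maps pick a monotone representative and pass to its other class. By
    \<open>eq\<close> the result does not depend on the choice, which makes the maps mutually
    inverse.\<close>
  define h where "h A = graph_limit_of (SOME W. W \<in> monotone_kernels \<and> ?L W = A)" for A
  define g where "g G = ?L (SOME W. W \<in> monotone_kernels \<and> graph_limit_of W = G)" for G
  have h: "h (?L W) = graph_limit_of W" if "W \<in> monotone_kernels" for W
    using someI[of "\<lambda>V. V \<in> monotone_kernels \<and> ?L V = ?L W" W] that eq by (auto simp: h_def)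
  have g: "g (graph_limit_of W) = ?L W" if "W \<in> monotone_kernels" for W
    using someI[of "\<lambda>V. V \<in> monotone_kernels \<and> graph_limit_of V = graph_limit_of W" W] that eq
    by (auto simp: g_def)
  have gh: "\<forall>A \<in> ?L ` monotone_kernels. g (h A) = A" and hg: "\<forall>G \<in> monotone_graph_limits. h (g G) = G"
    unfolding monotone_graph_limits_def by (simp_all add: h g)
  \<comment> \<open>Continuity is checked in the restricted metrics; at the end
    \<open>mtopology_submetric\<close> identifies their topologies with the subspace
    topologies.\<close>
  interpret L: Submetric "L1_space ?S" "L1_dist ?S" "?L ` monotone_kernels"
    by (intro Submetric.intro Metric_space_L1 Submetric_axioms.intro) (auto simp: L1_space_eq Ki)
  interpret G: Submetric graph_limits graph_limit_dist monotone_graph_limits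
    by (intro Submetric.intro Metric_space_graph_limits Submetric_axioms.intro)
      (auto simp: graph_limits_eq monotone_graph_limits_def dest: monotone_kernelsD(1))
  have dL: "L1_dist ?S (?L V) (?L W) = (\<integral>z. \<bar>V z - W z\<bar> \<partial>?S)"
    if "V \<in> monotone_kernels" "W \<in> monotone_kernels" for V W
    using that by (simp add: L1_dist_class Ki)
  have dG: "graph_limit_dist (graph_limit_of V) (graph_limit_of W) = cut_distance unit_leb V unit_leb W"
    if "V \<in> monotone_kernels" "W \<in> monotone_kernels" for V W
    using that by (simp add: graph_limit_dist_of monotone_kernelsD(1))
  have "continuous_map L.sub.mtopology G.sub.mtopology h"
    unfolding L.sub.metric_continuous_map[OF G.sub.Metric_space_axioms]
  proof (intro conjI ballI allI impI)
    show "h ` ?L ` monotone_kernels \<subseteq> monotone_graph_limits"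
      by (auto simp: h monotone_graph_limits_def)
    fix A and e :: real assume A: "A \<in> ?L ` monotone_kernels" and "0 < e"
    \<comment> \<open>\<open>h\<close> does not increase distances, so \<open>d = e\<close> serves
      in the continuity condition.\<close>
    have "graph_limit_dist (h A) (h B) \<le> L1_dist ?S A B" if "B \<in> ?L ` monotone_kernels" for B
      using A that by (auto simp: h dL dG intro!: cut_distance_le_L1[OF prob_space_unit_leb] monotone_kernelsD(1))
    then show "\<exists>d>0. \<forall>B. B \<in> ?L ` monotone_kernels \<and> L1_dist ?S A B < d \<longrightarrow> graph_limit_dist (h A) (h B) < e"
      using \<open>0 < e\<close> by (meson le_less_trans)
  qed
  moreover have "continuous_map G.sub.mtopology L.sub.mtopology g"
    unfolding G.sub.metric_continuous_map[OF L.sub.Metric_space_axioms]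
  proof (intro conjI ballI allI impI)
    show "g ` monotone_graph_limits \<subseteq> ?L ` monotone_kernels"
      by (auto simp: g monotone_graph_limits_def)
    fix A and e :: real assume "A \<in> monotone_graph_limits" and "0 < e"
    then obtain V where V: "V \<in> monotone_kernels" "A = graph_limit_of V"
      by (auto simp: monotone_graph_limits_def)
    \<comment> \<open>The threshold for \<open>e\<close> is uniform over monotone kernels, so
      \<open>g\<close> is even uniformly continuous.\<close>
    obtain d where "0 < d" and d: "\<And>V W. V \<in> monotone_kernels \<Longrightarrow> W \<in> monotone_kernels \<Longrightarrow>
        cut_distance unit_leb V unit_leb W < d \<Longrightarrow> (\<integral>z. \<bar>V z - W z\<bar> \<partial>?S) < e"
      using monotone_kernels_L1_small[OF \<open>0 < e\<close>] by blast
    then show "\<exists>d>0. \<forall>B. B \<in> monotone_graph_limits \<and> graph_limit_dist A B < d \<longrightarrow> L1_dist ?S (g A) (g B) < e"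
      using V by (intro exI[of _ d]) (auto simp: monotone_graph_limits_def g dL dG)
  qed
  ultimately have "homeomorphic_maps L.sub.mtopology G.sub.mtopology h g"
    unfolding homeomorphic_maps_def using gh hg by simp
  then have "homeomorphic_map L.sub.mtopology G.sub.mtopology h"
    by (rule homeomorphic_maps_imp_map)
  then show "\<exists>h. homeomorphic_map (subtopology (L1_topology ?S) (?L ` monotone_kernels))
      (subtopology graph_limit_topology monotone_graph_limits) h \<and>
      (\<forall>W\<in>monotone_kernels. h (?L W) = graph_limit_of W)"
    unfolding L.mtopology_submetric G.mtopology_submetric L1_topology_def graph_limit_topology_def
    using h by blast
qed

end
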